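(* Let $k\ge 3$ be a fixed integer. Let $f^{mon}_{\mathcal{S}_{k,k}}(n)$ denote the monotone threshold bias of the $(1:b)$ Avoider-Enforcer game on $E(K_n)$ in which Avoider loses iff his graph contains a copy of the double star $\mathcal{S}_{k,k}$, and let $f^{mon}_{\mathcal{PS}_{k,k}}(n)$ denote the monotone threshold bias of the analogous game for the path double star $\mathcal{PS}_{k,k}$. Then, as $n\to\infty$, (i) $f^{mon}_{\mathcal{S}_{k,k}}=\Theta(n^{\frac{k}{k-1}})$; (ii) $f^{mon}_{\mathcal{PS}_{k,k}}=\Theta(n^{\frac{k+1}{k}})$.
   Context: The double star $\mathcal{S}_{k,k}$ is the graph on $2k$ vertices $u,u_1,\dots,u_{k-1},v,v_1,\dots,v_{k-1}$ with edge set $\{uv\}\cup\{uu_i:1\le i\le k-1\}\cup\{vv_i:1\le i\le k-1\}$. The path double star $\mathcal{PS}_{k,k}$ is the graph on $2k+1$ vertices $w,u,u_1,\dots,u_{k-1},v,v_1,\dots,v_{k-1}$ with edge set $\{uu_i:1\le i\le k-1\}\cup\{vv_i:1\le i\le k-1\}\cup\{vw,uw\}$. For a fixed graph $H$, the monotone $(1:b)$ $H$-game on $E(K_n)$: Avoider and Enforcer alternately claim previously unclaimed edges of $K_n$, Avoider first; Avoider claims at least $1$ and Enforcer at least $b$ unclaimed edges per move (if fewer remain than required, the player claims all remaining ones); the game ends when all edges are claimed, and Avoider loses iff his claimed edges contain (the edge set of) a copy of $H$. The monotone threshold bias is the largest non-negative integer $f$ such that Enforcer wins this monotone $(1:b)$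 game if and only if $b\le f$. *)

theory Defs
  imports Complex_Main "HOL-Library.Landau_Symbols"
begin

type_synonym 'v graph = "'v set \<times> 'v set set"

abbreviation verts :: "'v graph \<Rightarrow> 'v set" where "verts \<equiv> fst"
abbreviation edges :: "'v graph \<Rightarrow> 'v set set" where "edges \<equiv> snd"

datatype ds_vertex = Center_u | Center_v | Middle_w | Leaf_u nat | Leaf_v nat

definition double_star :: "nat \<Rightarrow> ds_vertex graph" where
  "double_star k =
    ({Center_u, Center_v} \<union> Leaf_u ` {1..k-1} \<union> Leaf_v ` {1..k-1},
     {{Center_u, Center_v}}
       \<union> {{Center_u, Leaf_u i} |i. i \<in> {1..k-1}}
       \<union> {{Center_v, Leaf_v i} |i. i \<in> {1..k-1}})"

definition path_double_star :: "nat \<Rightarrow> ds_vertex graph" where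
  "path_double_star k =
    ({Middle_w, Center_u, Center_v} \<union> Leaf_u ` {1..k-1} \<union> Leaf_v ` {1..k-1},
     {{Center_u, Leaf_u i} |i. i \<in> {1..k-1}}
       \<union> {{Center_v, Leaf_v i} |i. i \<in> {1..k-1}}
       \<union> {{Center_v, Middle_w}, {Center_u, Middle_w}})"

definition complete_graph :: "nat \<Rightarrow> nat graph" where
  "complete_graph n = ({..<n}, {e. e \<subseteq> {..<n} \<and> card e = 2})"

definition copies :: "'v graph \<Rightarrow> 'w graph \<Rightarrow> 'w set set set" where
  "copies H G = {(`) \<phi> ` edges H |\<phi>.
     inj_on \<phi> (verts H) \<and> \<phi> ` verts H \<subseteq> verts G \<and> (`) \<phi> ` edges H \<subseteq> edges G}"

text \<open>In the monotone game a player of bias \<open>q\<close> claims at least \<open>q\<close> of the unclaimed elements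
  \<open>R\<close>, or all of \<open>R\<close> if fewer than \<open>q\<close> remain.\<close>

definition legal_move :: "nat \<Rightarrow> 'e set \<Rightarrow> 'e set \<Rightarrow> bool" where
  "legal_move q R S \<longleftrightarrow> S \<subseteq> R \<and> min q (card R) \<le> card S"

text \<open>Enforcer has a winning strategy in the monotone \<open>(1:b)\<close> game with losing sets \<open>\<F>\<close> from the
  position in which Avoider owns \<open>A\<close> and the elements of \<open>R\<close> are unclaimed. The two predicates
  differ in whether Avoider or Enforcer is to move. Enforcer's own elements do not affect the
  outcome, so they are not recorded.\<close>

inductive
  enforcer_wins_avoider_moves :: "'e set set \<Rightarrow> nat \<Rightarrow> 'e set \<Rightarrow> 'e set \<Rightarrow> bool" and
  enforcer_wins_enforcer_moves :: "'e set set \<Rightarrow> nat \<Rightarrow> 'e set \<Rightarrow> 'e set \<Rightarrow> bool"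
  for \<F> :: "'e set set" and b :: nat
where
  avoider_end: "\<exists>F\<in>\<F>. F \<subseteq> A \<Longrightarrow> enforcer_wins_avoider_moves \<F> b A {}"
| enforcer_end: "\<exists>F\<in>\<F>. F \<subseteq> A \<Longrightarrow> enforcer_wins_enforcer_moves \<F> b A {}"
| avoider_step: "R \<noteq> {} \<Longrightarrow>
    (\<And>S. legal_move 1 R S \<Longrightarrow> enforcer_wins_enforcer_moves \<F> b (A \<union> S) (R - S)) \<Longrightarrow>
    enforcer_wins_avoider_moves \<F> b A R"
| enforcer_step: "R \<noteq> {} \<Longrightarrow> legal_move b R S \<Longrightarrow>
    enforcer_wins_avoider_moves \<F> b A (R - S) \<Longrightarrow>
    enforcer_wins_enforcer_moves \<F> b A R"

definition enforcer_wins :: "'v graph \<Rightarrow> nat \<Rightarrow> nat \<Rightarrow> bool" where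
  "enforcer_wins H n b \<longleftrightarrow>
    enforcer_wins_avoider_moves (copies H (complete_graph n)) b {} (edges (complete_graph n))"

text \<open>Biases are positive integers, so the value is \<open>0\<close> if Enforcer wins for no bias, e.g. if
  \<open>H\<close> does not embed into the complete graph.\<close>

definition mon_threshold_bias :: "'v graph \<Rightarrow> nat \<Rightarrow> nat" where
  "mon_threshold_bias H n = (GREATEST f. \<forall>b\<ge>1. enforcer_wins H n b \<longleftrightarrow> b \<le> f)"

text \<open>The threshold is well defined for every \<open>H\<close> with at least two edges.\<close>

lemma enforcer_wins_bias_mono_aux:
  "(enforcer_wins_avoider_moves \<F> b A R \<longrightarrow> b' \<le> b \<longrightarrow> enforcer_wins_avoider_moves \<F> b' A R) \<and>
   (enforcer_wins_enforcer_moves \<F> b A2 R2 \<longrightarrow> b' \<le> b \<longrightarrow>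
     enforcer_wins_enforcer_moves \<F> b' A2 R2)"
proof (induction rule: enforcer_wins_avoider_moves_enforcer_wins_enforcer_moves.induct)
  case (enforcer_step R S A)
  show ?case
  proof
    assume "b' \<le> b"
    moreover from this have "legal_move b' R S"
      using enforcer_step(2) by (auto simp: legal_move_def)
    ultimately show "enforcer_wins_enforcer_moves \<F> b' A R"
      using enforcer_step(1,4) enforcer_wins_avoider_moves_enforcer_wins_enforcer_moves.enforcer_step[of R b' S \<F> A]
      by blast
  qed
next
  case (avoider_step R A)
  then show ?case
    using enforcer_wins_avoider_moves_enforcer_wins_enforcer_moves.avoider_step[of R \<F> b' A] by blast
qed (simp_all add: enforcer_wins_avoider_moves_enforcer_wins_enforcer_moves.avoider_end
  enforcer_wins_avoider_moves_enforcer_wins_enforcer_moves.enforcer_end)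

lemma enforcer_wins_bias_mono: "enforcer_wins H n b \<Longrightarrow> b' \<le> b \<Longrightarrow> enforcer_wins H n b'"
  using enforcer_wins_bias_mono_aux unfolding enforcer_wins_def by blast

lemma finite_edges_complete_graph: "finite (edges (complete_graph n))"
  by (auto simp: complete_graph_def intro: finite_subset[of _ "Pow {..<n}"])

lemma card_copies:
  assumes "F \<in> copies H G" "\<Union> (edges H) \<subseteq> verts H"
  shows "card F = card (edges H)"
proof -
  obtain \<phi> where \<phi>: "F = (`) \<phi> ` edges H" "inj_on \<phi> (verts H)"
    using assms(1) by (auto simp: copies_def)
  have "inj_on ((`) \<phi>) (edges H)"
    using inj_on_image[of \<phi> "edges H"] inj_on_subset[OF \<phi>(2) assms(2)] by blast
  then show ?thesis by (simp add: \<phi>(1) card_image)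
qed

lemma enforcer_loses_large_bias:
  assumes H: "\<Union> (edges H) \<subseteq> verts H" "2 \<le> card (edges H)"
    and b: "card (edges (complete_graph n)) \<le> b"
  shows "\<not> enforcer_wins H n b"
proof
  let ?X = "edges (complete_graph n)" and ?F = "copies H (complete_graph n)"
  have small: "\<not> (\<exists>F\<in>?F. F \<subseteq> A)" if "card A \<le> 1" "finite A" for A
  proof
    assume "\<exists>F\<in>?F. F \<subseteq> A"
    then obtain F where "F \<in> ?F" "F \<subseteq> A" by blast
    then show False
      using card_copies[OF _ H(1), of F] H(2) card_mono[OF that(2), of F] that(1) by simp
  qed
  assume "enforcer_wins H n b"
  then have "enforcer_wins_avoider_moves ?F b {} ?X" by (simp add: enforcer_wins_def)
  then show False
  proof cases
    case avoider_end
    then show ?thesis using small[of "{}"] by simp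
  next
    case avoider_step
    then obtain e where e: "e \<in> ?X" by blast
    then have "legal_move 1 ?X {e}" by (simp add: legal_move_def)
    with avoider_step have "enforcer_wins_enforcer_moves ?F b {e} (?X - {e})" by force
    then show ?thesis
    proof cases
      case enforcer_end
      then show ?thesis using small[of "{e}"] by simp
    next
      case (enforcer_step S)
      have fin: "finite (?X - {e})" using finite_edges_complete_graph by blast
      have "card (?X - {e}) \<le> b"
        using b card_Diff1_le[of ?X e] by linarith
      then have "S = ?X - {e}"
        using enforcer_step(2) fin by (auto simp: legal_move_def card_seteq)
      then have "enforcer_wins_avoider_moves ?F b {e} {}"
        using enforcer_step(3) by simp
      then show ?thesis
        by cases (use small[of "{e}"] in auto)
    qed
  qed
qed

theorem mon_threshold_bias_iff:
  assumes H: "\<Union> (edges H) \<subseteq> verts H" "2 \<le> card (edges H)" and "1 \<le> b"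
  shows "enforcer_wins H n b \<longleftrightarrow> b \<le> mon_threshold_bias H n"
proof -
  let ?P = "\<lambda>f. \<forall>b\<ge>1. enforcer_wins H n b \<longleftrightarrow> b \<le> f"
  let ?N = "card (edges (complete_graph n))"
  define Bs where "Bs = {b. b \<ge> 1 \<and> enforcer_wins H n b}"
  have bound: "b \<le> ?N" if "enforcer_wins H n b" for b
    using enforcer_loses_large_bias[OF H, of n b] that by linarith
  have fin: "finite (insert 0 Bs)"
    by (rule finite_subset[of _ "{..?N}"]) (auto simp: Bs_def bound)
  define f where "f = Max (insert 0 Bs)"
  have fin': "f \<in> insert 0 Bs" unfolding f_def using fin by (rule Max_in) simp
  have "?P f"
  proof (intro allI impI iffI)
    fix b :: nat assume "1 \<le> b" "enforcer_wins H n b"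
    then show "b \<le> f" unfolding f_def using fin by (auto simp: Bs_def intro: Max_ge)
  next
    fix b :: nat assume "1 \<le> b" "b \<le> f"
    then show "enforcer_wins H n b"
      using fin' enforcer_wins_bias_mono[of H n f b] by (auto simp: Bs_def)
  qed
  moreover have "g \<le> f" if "?P g" for g
    using that \<open>?P f\<close> by (cases "g = 0") auto
  ultimately have "mon_threshold_bias H n = f"
    unfolding mon_threshold_bias_def by (intro Greatest_equality) auto
  with \<open>?P f\<close> \<open>1 \<le> b\<close> show ?thesis by blast
qed

end

theory Submission
  imports Defs
begin

text \<open>Put \<open>m = k - 1\<close> for the double star and \<open>m = k\<close> for the path double star.

  Upper bound: deleting any edge from a copy of the forbidden graph leaves a star with \<open>m\<close>
  edges. Avoider gives each such star without Enforcer edges the weight \<open>(1 + b/m)\<close> to the number of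
  his own edges in it and always takes the edge of least weight; then the total weight, at most
  \<open>n ^ (m + 1)\<close> initially, never grows, and while it is below \<open>(1 + b/m) ^ m\<close> he owns no such star.

  Lower bound: Enforcer splits the vertices into blocks and lets Avoider play only in boxes, each
  consisting essentially of the edges from one vertex to a block, of size about \<open>n/4\<close>. After each move of
  Avoider he destroys \<open>t\<close> of the boxes with the fewest Avoider edges, which costs about \<open>t n/4\<close>
  edges. If \<open>(t + 1) ^ m\<close> is a small fraction of \<open>n\<close>, Avoider must fill some box up to \<open>m\<close> edges, which
  gives the first centre. A second box game on the other half of the vertices gives the second
  centre, up to one missing edge, and then Enforcer claims everything but that edge. A graph with
  linearly many edges contains the forbidden graph anyway, so Avoider cannot spoil the count by
  claiming many edges at once.\<close>

section \<open>Game positions\<close>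

text \<open>Both bounds meet at the exponent \<open>(m + 1) / m\<close>: a win of Enforcer requires
  \<open>(1 + b/m) ^ m \<le> n ^ (m + 1)\<close>, while the box game allows \<open>t\<close> of
  order \<open>n powr (1/m)\<close> and so a bias of order \<open>t * n\<close>. Enforcer's obstacle
  is the link between the centres. Avoider determines the first centre and would then shun the edges
  towards a second one. So the linking edges are put into the boxes of the candidates and count
  towards their level; at level \<open>m\<close> only one edge is missing, matching the one deleted
  edge of the upper bound. For the double star the link is a single edge; for the path double star
  it is a path of length two whose midpoint is not known in advance, which is why boxes have to
  shrink and overlap. Avoider also decides in which half the first centre appears. Hence both halves
  are played from the start, each with a reserve of its own, and the other half is still well
  stocked when the second stage begins.\<close>

lemma enforcer_wins_if_claimed:
  assumes "F \<in> \<F>" "F \<subseteq> A" "finite R"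
  shows "enforcer_wins_enforcer_moves \<F> b A R"
proof (cases "R = {}")
  case True
  then show ?thesis using assms by (auto intro: enforcer_end)
next
  case False
  moreover have "legal_move b R R" by (simp add: legal_move_def)
  moreover have "enforcer_wins_avoider_moves \<F> b A (R - R)"
    using assms by (auto intro: avoider_end)
  ultimately show ?thesis by (rule enforcer_step)
qed

text \<open>Enforcer may exceed his bias, so he leaves only \<open>e\<close>, which Avoider must
  then claim. Strictness of \<open>b < card R\<close> is what makes leaving one element behind
  legal.\<close>

lemma enforcer_wins_if_threat:
  assumes "e \<in> R" "F \<in> \<F>" "F \<subseteq> insert e A" "b < card R" "finite R"
  shows "enforcer_wins_enforcer_moves \<F> b A R"
proof (rule enforcer_step)
  show "R \<noteq> {}" using assms by auto
  show "legal_move b R (R - {e})" using assms by (auto simp: legal_move_def)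
  have "R - (R - {e}) = {e}" using assms by auto
  moreover have "enforcer_wins_avoider_moves \<F> b A {e}"
  proof (rule avoider_step)
    fix S assume "legal_move 1 {e} S"
    then have "S \<subseteq> {e}" "card S \<ge> 1" by (auto simp: legal_move_def)
    then have "S = {e}" by (metis card.empty not_one_le_zero subset_singletonD)
    then show "enforcer_wins_enforcer_moves \<F> b (A \<union> S) ({e} - S)"
      using assms by (auto intro!: enforcer_end)
  qed simp
  ultimately show "enforcer_wins_avoider_moves \<F> b A (R - (R - {e}))" by simp
qed

section \<open>Avoider's potential\<close>

text \<open>A biased Erdos-Selfridge weight function. Enforcer's elements are not recorded;
  \<open>g \<subseteq> A \<union> R\<close> expresses that he owns none of \<open>g\<close>.\<close>

definition potential :: "real \<Rightarrow> 'e set set \<Rightarrow> 'e set \<Rightarrow> 'e set \<Rightarrow> real" where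
  "potential lam \<G> A R = (\<Sum>g\<in>{g\<in>\<G>. g \<subseteq> A \<union> R}. lam ^ card (g \<inter> A))"

lemma potential_ge_member:
  assumes "finite \<G>" "g \<in> \<G>" "g \<subseteq> A" "0 \<le> lam"
  shows "lam ^ card g \<le> potential lam \<G> A R"
proof -
  have "lam ^ card g = lam ^ card (g \<inter> A)" using assms(3) by (simp add: Int_absorb2)
  also have "\<dots> \<le> potential lam \<G> A R"
    unfolding potential_def using assms by (intro member_le_sum) auto
  finally show ?thesis .
qed

text \<open>Avoider takes an element whose sets have the least total weight; each of the \<open>b\<close> elements
  taken by Enforcer then destroys at least as much weight, and a set is counted at most \<open>m\<close> times.\<close>

lemma potential_round_le:
  fixes A R S :: "'e set"
  assumes G: "finite \<G>" "\<And>g. g \<in> \<G> \<Longrightarrow> finite g \<and> card g \<le> m" and m: "1 \<le> m"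
    and A: "A \<inter> R = {}"
    and x: "x \<in> R" and S: "S \<subseteq> R - {x}" "finite S" "b \<le> card S"
    and lam: "lam = 1 + real b / real m"
    and min: "\<And>y. y \<in> R \<Longrightarrow>
      (\<Sum>g\<in>{g\<in>\<G>. g \<subseteq> A \<union> R \<and> x \<in> g}. lam ^ card (g \<inter> A))
      \<le> (\<Sum>g\<in>{g\<in>\<G>. g \<subseteq> A \<union> R \<and> y \<in> g}. lam ^ card (g \<inter> A))"
  shows "potential lam \<G> (insert x A) (R - {x} - S) \<le> potential lam \<G> A R"
proof -
  define P where "P = {g\<in>\<G>. g \<subseteq> A \<union> R}"
  define P' where "P' = {g\<in>P. g \<inter> S = {}}"
  define w where "w g = lam ^ card (g \<inter> A)" for g
  define \<phi> where "\<phi> y = (\<Sum>g\<in>{g\<in>P. y \<in> g}. w g)" for y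
  have finP: "finite P" "finite P'" using G(1) by (auto simp: P_def P'_def)
  have lam1: "lam \<ge> 1" using lam by simp
  have w0: "w g \<ge> 0" for g using lam1 by (simp add: w_def)
  have eqset: "{g\<in>P. y \<in> g} = {g\<in>\<G>. g \<subseteq> A \<union> R \<and> y \<in> g}" for y by (auto simp: P_def)
  have min': "\<phi> x \<le> \<phi> y" if "y \<in> R" for y
    using min[OF that] unfolding \<phi>_def eqset w_def .
  have P'eq: "{g\<in>\<G>. g \<subseteq> insert x A \<union> (R - {x} - S)} = P'"
    using x S(1) A by (auto simp: P_def P'_def)
  have w': "lam ^ card (g \<inter> insert x A) = w g + (lam - 1) * (if x \<in> g then w g else 0)"
    if "g \<in> P'" for g
  proof (cases "x \<in> g")
    case True
    have "finite g" using that G(2) by (auto simp: P'_def P_def)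
    moreover have "x \<notin> A" using x A by auto
    ultimately have "card (g \<inter> insert x A) = Suc (card (g \<inter> A))" using True by simp
    then show ?thesis using True by (simp add: w_def algebra_simps)
  qed (simp add: w_def)
  have "(\<Sum>g\<in>P'. if x \<in> g then w g else 0) = (\<Sum>g\<in>{g\<in>P'. x \<in> g}. w g)"
    using finP by (simp add: sum.inter_filter)
  also have "\<dots> \<le> \<phi> x"
    unfolding \<phi>_def using finP w0 by (intro sum_mono2) (auto simp: P'_def)
  finally have 1: "(\<Sum>g\<in>P'. if x \<in> g then w g else 0) \<le> \<phi> x" .
  have phi0: "\<phi> x \<ge> 0" unfolding \<phi>_def using w0 by (intro sum_nonneg) auto
  have "real b * \<phi> x \<le> real (card S) * \<phi> x" using S(3) phi0 by (intro mult_right_mono) auto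
  also have "\<dots> = (\<Sum>y\<in>S. \<phi> x)" by simp
  also have "\<dots> \<le> (\<Sum>y\<in>S. \<phi> y)" using S(1) min' by (intro sum_mono) auto
  \<comment> \<open>Double counting of the pairs of an element \<open>y\<close> of \<open>S\<close>
    and a set containing it: only the sets outside \<open>P'\<close> are hit, each at most
    \<open>m\<close> times.\<close>
  also have "\<dots> = (\<Sum>y\<in>S. \<Sum>g\<in>P. if y \<in> g then w g else 0)"
    unfolding \<phi>_def using finP by (simp add: sum.inter_filter)
  also have "\<dots> = (\<Sum>g\<in>P. \<Sum>y\<in>S. if y \<in> g then w g else 0)" by (rule sum.swap)
  also have "\<dots> = (\<Sum>g\<in>P. real (card {y\<in>S. y \<in> g}) * w g)"
    using S(2) by (simp add: sum.inter_filter[symmetric])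
  also have "\<dots> = (\<Sum>g\<in>P - P'. real (card {y\<in>S. y \<in> g}) * w g)"
  proof (rule sum.mono_neutral_right[OF finP(1)])
    show "\<forall>i\<in>P - (P - P'). real (card {y \<in> S. y \<in> i}) * w i = 0"
    proof
      fix g assume "g \<in> P - (P - P')"
      then have "{y \<in> S. y \<in> g} = {}" by (auto simp: P'_def)
      then show "real (card {y \<in> S. y \<in> g}) * w g = 0" by (simp only: card.empty mult_zero_left of_nat_0)
    qed
  qed auto
  also have "\<dots> \<le> (\<Sum>g\<in>P - P'. real m * w g)"
  proof (rule sum_mono)
    fix g assume "g \<in> P - P'"
    then have "finite g" "card g \<le> m" using G(2) by (auto simp: P_def)
    then have "card {y\<in>S. y \<in> g} \<le> m"
      using card_mono[of g "{y\<in>S. y \<in> g}"] by fastforce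
    then show "real (card {y\<in>S. y \<in> g}) * w g \<le> real m * w g"
      using w0 by (intro mult_right_mono) auto
  qed
  finally have "real b * \<phi> x \<le> real m * (\<Sum>g\<in>P - P'. w g)" by (simp add: sum_distrib_left)
  \<comment> \<open>This fixes \<open>lam\<close>: as \<open>lam - 1 = b/m\<close>, the weight
    destroyed by Enforcer covers the gain from claiming \<open>x\<close>.\<close>
  then have 2: "(lam - 1) * \<phi> x \<le> (\<Sum>g\<in>P - P'. w g)"
    using m lam by (simp add: pos_divide_le_eq mult.commute)
  have "potential lam \<G> (insert x A) (R - {x} - S) = (\<Sum>g\<in>P'. lam ^ card (g \<inter> insert x A))"
    unfolding potential_def P'eq ..
  also have "\<dots> = (\<Sum>g\<in>P'. w g) + (lam - 1) * (\<Sum>g\<in>P'. if x \<in> g then w g else 0)"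
    by (simp add: w' sum.distrib sum_distrib_left)
  also have "\<dots> \<le> (\<Sum>g\<in>P'. w g) + (lam - 1) * \<phi> x"
    using 1 lam1 by (intro add_left_mono mult_left_mono) auto
  also have "\<dots> \<le> (\<Sum>g\<in>P'. w g) + (\<Sum>g\<in>P - P'. w g)" using 2 by simp
  also have "\<dots> = (\<Sum>g\<in>P. w g)"
    using finP by (subst add.commute, subst sum.subset_diff[of P' P]) (auto simp: P'_def)
  finally show ?thesis unfolding potential_def P_def w_def .
qed

text \<open>The potential is controlled only when Avoider is to move, so the sets \<open>g\<close>
  are watched instead of \<open>F\<close>: if \<open>x\<close> completed \<open>F\<close>, then
  \<open>F - {x}\<close>, and with it some \<open>g\<close> of weight \<open>lam ^ m\<close>, would
  have been his before.\<close>

lemma avoider_wins_if_potential_small: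
  fixes A R :: "'e set"
  assumes G: "finite \<G>" "\<And>g. g \<in> \<G> \<Longrightarrow> finite g \<and> card g = m" and m: "1 \<le> m"
    and lam: "lam = 1 + real b / real m"
    and FG: "\<And>F e. F \<in> \<F> \<Longrightarrow> \<exists>g\<in>\<G>. g \<subseteq> F - {e}"
    and "finite R" "A \<inter> R = {}" "potential lam \<G> A R < lam ^ m"
  shows "\<not> enforcer_wins_avoider_moves \<F> b A R"
  using assms(6-8)
proof (induction "card R" arbitrary: A R rule: less_induct)
  case less
  have lam1: "lam \<ge> 1" using lam by simp
  have noF: "\<not> F \<subseteq> insert x A" if F: "F \<in> \<F>" for F x
  proof
    assume "F \<subseteq> insert x A"
    moreover obtain g where g: "g \<in> \<G>" "g \<subseteq> F - {x}" using FG[OF F] by blast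
    ultimately have "g \<subseteq> A" by auto
    with g G lam1 potential_ge_member[of \<G> g A lam R] less.prems show False by force
  qed
  show ?case
  proof
    assume "enforcer_wins_avoider_moves \<F> b A R"
    then show False
    proof cases
      case avoider_end
      then show ?thesis using noF by blast
    next
      case avoider_step
      define \<phi> where "\<phi> y = (\<Sum>g\<in>{g\<in>\<G>. g \<subseteq> A \<union> R \<and> y \<in> g}. lam ^ card (g \<inter> A))" for y
      define x where "x = arg_min_on \<phi> R"
      have x: "x \<in> R" "\<And>y. y \<in> R \<Longrightarrow> \<phi> x \<le> \<phi> y"
        unfolding x_def using less.prems avoider_step(1)
        by (auto intro: arg_min_if_finite arg_min_least)
      have "legal_move 1 R {x}" using x by (simp add: legal_move_def)
      with avoider_step have "enforcer_wins_enforcer_moves \<F> b (insert x A) (R - {x})" by force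
      then show ?thesis
      proof cases
        case enforcer_end
        then show ?thesis using noF by blast
      next
        case (enforcer_step S)
        have S: "S \<subseteq> R - {x}" "min b (card (R - {x})) \<le> card S"
          using enforcer_step(2) by (auto simp: legal_move_def)
        show ?thesis
        proof (cases "b \<le> card S")
          case True
          have "potential lam \<G> (insert x A) (R - {x} - S) \<le> potential lam \<G> A R"
            using G m less.prems x S True lam finite_subset[OF S(1)]
            by (intro potential_round_le[where m=m and b=b]) (auto simp: \<phi>_def)
          moreover have "card (R - {x} - S) < card R"
            using x less.prems by (intro psubset_card_mono) auto
          ultimately have "\<not> enforcer_wins_avoider_moves \<F> b (insert x A) (R - {x} - S)"
            using less.prems by (intro less.hyps) auto
          then show ?thesis using enforcer_step(3) by blast
        next
          \<comment> \<open>In the last round Enforcer may take fewer than \<open>b\<close> elements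
            and the potential may grow, but then the game is over and Avoider has added only
            \<open>x\<close>.\<close>
          case False
          then have "S = R - {x}" using S less.prems by (intro card_seteq) auto
          then have "enforcer_wins_avoider_moves \<F> b (insert x A) {}"
            using enforcer_step(3) by simp
          then show ?thesis by cases (use noF in auto)
        qed
      qed
    qed
  qed
qed

section \<open>Stars\<close>

definition star :: "'v \<Rightarrow> 'v set \<Rightarrow> 'v set set" where
  "star x Y = (\<lambda>y. {x, y}) ` Y"

definition stars :: "nat \<Rightarrow> nat \<Rightarrow> nat set set set" where
  "stars n m = {star x Y |x Y. x < n \<and> Y \<subseteq> {..<n} \<and> x \<notin> Y \<and> card Y = m}"

lemma inj_on_pair: "inj_on (\<lambda>y. {x, y}) Y"
  by (rule inj_onI) (auto simp: doubleton_eq_iff)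

lemma card_star [simp]: "card (star x Y) = card Y"
  unfolding star_def by (rule card_image[OF inj_on_pair])

lemma star_mono: "Y \<subseteq> Z \<Longrightarrow> star x Y \<subseteq> star x Z"
  by (auto simp: star_def)

lemma finite_card_stars: "finite (stars n m)" "card (stars n m) \<le> n ^ Suc m"
proof -
  let ?T = "{Y. Y \<subseteq> {..<n} \<and> card Y = m}"
  let ?D = "{..<n} \<times> ?T"
  have sub: "stars n m \<subseteq> (\<lambda>(x, Y). star x Y) ` ?D" by (auto simp: stars_def)
  have fin: "finite ?D" by (auto intro: finite_subset[of _ "Pow {..<n}"])
  show "finite (stars n m)" using finite_subset[OF sub] fin by blast
  have "card (stars n m) \<le> card ((\<lambda>(x, Y). star x Y) ` ?D)"
    using sub fin by (intro card_mono) auto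
  also have "\<dots> \<le> card ?D" using fin by (rule card_image_le)
  also have "\<dots> = n * (n choose m)" by (simp add: card_cartesian_product n_subsets)
  also have "(n choose m) \<le> n ^ m"
    by (cases "m \<le> n") (auto intro: binomial_le_pow simp: binomial_eq_0)
  finally show "card (stars n m) \<le> n ^ Suc m" by simp
qed

lemma star_subset_minus_edge:
  assumes "x < n" "Y \<subseteq> {..<n}" "x \<notin> Y" "Suc m \<le> card Y"
  shows "\<exists>g\<in>stars n m. g \<subseteq> star x Y - {e}"
proof -
  define Z where "Z = {y\<in>Y. {x, y} \<noteq> e}"
  have fin: "finite Y" using assms(2) finite_subset by blast
  have "\<exists>y. Y \<subseteq> insert y Z"
  proof (cases "\<exists>y. e = {x, y}")
    case True
    then obtain y where "e = {x, y}" ..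
    then have "Y \<subseteq> insert y Z" by (auto simp: Z_def doubleton_eq_iff)
    then show ?thesis ..
  next
    case False
    then show ?thesis by (auto simp: Z_def)
  qed
  then obtain y where "Y \<subseteq> insert y Z" ..
  moreover have finZ: "finite Z" using fin by (simp add: Z_def)
  ultimately have "card Y \<le> card (insert y Z)" by (intro card_mono) auto
  also have "\<dots> \<le> Suc (card Z)" using finZ by (simp add: card_insert_if)
  finally have "card Y \<le> Suc (card Z)" .
  then have "m \<le> card Z" using assms(4) by simp
  then obtain T where T: "T \<subseteq> Z" "card T = m" by (meson obtain_subset_with_card_n)
  have "star x T \<in> stars n m" using T assms by (auto simp: stars_def Z_def)
  moreover have "star x T \<subseteq> star x Y - {e}" using T by (auto simp: star_def Z_def)
  ultimately show ?thesis ..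
qed

section \<open>Upper bound on the threshold bias\<close>

lemma avoider_wins_if_stars_unavoidable:
  assumes "1 \<le> m"
    and "\<And>F e. F \<in> copies H (complete_graph n) \<Longrightarrow> \<exists>g\<in>stars n m. g \<subseteq> F - {e}"
    and "real n ^ Suc m < (1 + real b / real m) ^ m"
  shows "\<not> enforcer_wins H n b"
proof -
  let ?lam = "1 + real b / real m"
  have "potential ?lam (stars n m) {} (edges (complete_graph n)) \<le> real (card (stars n m))"
    unfolding potential_def using finite_card_stars(1)[of n m] by (auto intro!: card_mono)
  also have "\<dots> \<le> real (n ^ Suc m)" using finite_card_stars(2)[of n m] by linarith
  also have "\<dots> < ?lam ^ m" using assms(3) by simp
  finally have small: "potential ?lam (stars n m) {} (edges (complete_graph n)) < ?lam ^ m" .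
  have "finite g \<and> card g = m" if "g \<in> stars n m" for g
  proof -
    obtain x Y where "g = star x Y" "Y \<subseteq> {..<n}" "card Y = m"
      using \<open>g \<in> stars n m\<close> by (auto simp: stars_def)
    moreover from this have "finite Y" using finite_subset by blast
    ultimately show ?thesis by (simp add: card_star) (simp add: star_def)
  qed
  with small show ?thesis
    unfolding enforcer_wins_def using assms(1,2) finite_card_stars(1) finite_edges_complete_graph
    by (intro avoider_wins_if_potential_small[where m=m]) auto
qed

lemma mon_threshold_bias_le:
  assumes H: "\<Union> (edges H) \<subseteq> verts H" "2 \<le> card (edges H)" and m: "1 \<le> m"
    and FG: "\<And>F e. F \<in> copies H (complete_graph n) \<Longrightarrow> \<exists>g\<in>stars n m. g \<subseteq> F - {e}"
  shows "real (mon_threshold_bias H n) \<le> real m * real n powr ((real m + 1) / real m)"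
proof (rule ccontr)
  define f where "f = mon_threshold_bias H n"
  let ?p = "real n powr ((real m + 1) / real m)"
  assume "\<not> ?thesis"
  then have gt: "real f > real m * ?p" by (simp add: f_def)
  moreover have p0: "real m * ?p \<ge> 0" by simp
  ultimately have "f \<ge> 1" by (cases f) auto
  then have win: "enforcer_wins H n f" using mon_threshold_bias_iff[OF H, of f n] f_def by simp
  have "?p < 1 + real f / real m" using gt m by (simp add: field_simps)
  then have "?p ^ m < (1 + real f / real m) ^ m" using m by (intro power_strict_mono) auto
  moreover have "?p ^ m = real n ^ Suc m"
  proof (cases "n = 0")
    case True
    then show ?thesis using m by simp
  next
    case False
    then have "?p ^ m = real n powr (real m * ((real m + 1) / real m))"
      by (simp add: powr_powr powr_realpow[symmetric] mult.commute)
    also have "real m * ((real m + 1) / real m) = real (Suc m)" using m by simp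
    finally show ?thesis using False by (simp add: powr_realpow del: of_nat_Suc)
  qed
  ultimately show False using avoider_wins_if_stars_unavoidable[of m H n f] m FG win by simp
qed

section \<open>Stars in the forbidden graphs after deleting an edge\<close>

lemma double_star_wf:
  assumes "k \<ge> 3"
  shows "\<Union> (edges (double_star k)) \<subseteq> verts (double_star k)" "2 \<le> card (edges (double_star k))"
proof -
  show "\<Union> (edges (double_star k)) \<subseteq> verts (double_star k)"
    by (auto simp: double_star_def)
  have "finite (edges (double_star k))" by (simp add: double_star_def)
  moreover have "{{Center_u, Center_v}, {Center_u, Leaf_u 1}} \<subseteq> edges (double_star k)"
    using assms by (auto simp: double_star_def)
  moreover have "card {{Center_u, Center_v}, {Center_u, Leaf_u 1}} = 2"
    by (auto simp: doubleton_eq_iff card_2_iff)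
  ultimately show "2 \<le> card (edges (double_star k))" by (metis card_mono)
qed

lemma path_double_star_wf:
  assumes "k \<ge> 3"
  shows "\<Union> (edges (path_double_star k)) \<subseteq> verts (path_double_star k)"
    "2 \<le> card (edges (path_double_star k))"
proof -
  show "\<Union> (edges (path_double_star k)) \<subseteq> verts (path_double_star k)"
    by (auto simp: path_double_star_def)
  have "finite (edges (path_double_star k))" by (simp add: path_double_star_def)
  moreover have "{{Center_v, Middle_w}, {Center_u, Middle_w}} \<subseteq> edges (path_double_star k)"
    by (auto simp: path_double_star_def)
  moreover have "card {{Center_v, Middle_w}, {Center_u, Middle_w}} = 2"
    by (auto simp: doubleton_eq_iff card_2_iff)
  ultimately show "2 \<le> card (edges (path_double_star k))" by (metis card_mono)
qed

text \<open>\<open>Center_u\<close> has degree \<open>k\<close>, counting \<open>Center_v\<close>,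
  and its star loses at most one edge; hence \<open>m = k - 1\<close>.\<close>

lemma double_star_copy_minus_edge:
  assumes "k \<ge> 3" "F \<in> copies (double_star k) (complete_graph n)"
  shows "\<exists>g\<in>stars n (k - 1). g \<subseteq> F - {e}"
proof -
  obtain \<phi> where \<phi>: "F = (`) \<phi> ` edges (double_star k)" "inj_on \<phi> (verts (double_star k))"
    "\<phi> ` verts (double_star k) \<subseteq> {..<n}"
    using assms(2) by (auto simp: copies_def complete_graph_def)
  define W where "W = insert Center_v (Leaf_u ` {1..k-1})"
  have W: "W \<subseteq> verts (double_star k)" "Center_u \<in> verts (double_star k)" "Center_u \<notin> W"
    by (auto simp: W_def double_star_def)
  have "card W = Suc (k - 1)"
    unfolding W_def by (subst card_insert_disjoint) (auto simp: card_image inj_on_def)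
  then have c: "card (\<phi> ` W) = Suc (k - 1)"
    using inj_on_subset[OF \<phi>(2) W(1)] by (simp add: card_image)
  have nin: "\<phi> Center_u \<notin> \<phi> ` W" using W \<phi>(2) by (auto simp: inj_on_def)
  have "star (\<phi> Center_u) (\<phi> ` W) \<subseteq> F"
  proof -
    have "{Center_u, w} \<in> edges (double_star k)" if "w \<in> W" for w
      using that by (auto simp: W_def double_star_def)
    then have "\<phi> ` {Center_u, w} \<in> F" if "w \<in> W" for w using that \<phi>(1) by blast
    then show ?thesis by (auto simp: star_def)
  qed
  moreover have "\<phi> Center_u < n" "\<phi> ` W \<subseteq> {..<n}" using W \<phi>(3) by auto
  moreover from this obtain g where
    "g \<in> stars n (k - 1)" "g \<subseteq> star (\<phi> Center_u) (\<phi> ` W) - {e}"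
    using star_subset_minus_edge[OF _ _ nin, of n "k - 1" e] c by auto
  ultimately show ?thesis by blast
qed

text \<open>Both centres have degree \<open>k\<close>, counting \<open>Middle_w\<close>, and since
  they are not adjacent their stars share no edge. The deleted edge misses one of the stars, which
  keeps all \<open>k\<close> edges; hence \<open>m = k\<close>.\<close>

lemma path_double_star_copy_minus_edge:
  assumes "k \<ge> 3" "F \<in> copies (path_double_star k) (complete_graph n)"
  shows "\<exists>g\<in>stars n k. g \<subseteq> F - {e}"
proof -
  let ?V = "verts (path_double_star k)"
  obtain \<phi> where \<phi>: "F = (`) \<phi> ` edges (path_double_star k)" "inj_on \<phi> ?V"
    "\<phi> ` ?V \<subseteq> {..<n}"
    using assms(2) by (auto simp: copies_def complete_graph_def)
  define Wu where "Wu = insert Middle_w (Leaf_u ` {1..k-1})"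
  define Wv where "Wv = insert Middle_w (Leaf_v ` {1..k-1})"
  have W: "Wu \<subseteq> ?V" "Wv \<subseteq> ?V" "Center_u \<in> ?V" "Center_v \<in> ?V"
    and nin: "Center_u \<notin> Wu" "Center_v \<notin> Wv" "Center_u \<notin> Wv"
    by (auto simp: Wu_def Wv_def path_double_star_def)
  have "card Wu = k" "card Wv = k"
    unfolding Wu_def Wv_def using assms(1)
    by (subst card_insert_disjoint; auto simp: card_image inj_on_def)+
  then have c: "card (\<phi> ` Wu) = k" "card (\<phi> ` Wv) = k"
    using inj_on_subset[OF \<phi>(2)] W by (simp_all add: card_image)
  have "{Center_u, w} \<in> edges (path_double_star k)" if "w \<in> Wu" for w
    using that by (auto simp: Wu_def path_double_star_def)
  then have "\<phi> ` {Center_u, w} \<in> F" if "w \<in> Wu" for w using that \<phi>(1) by blast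
  then have u: "star (\<phi> Center_u) (\<phi> ` Wu) \<subseteq> F" by (auto simp: star_def)
  have "{Center_v, w} \<in> edges (path_double_star k)" if "w \<in> Wv" for w
    using that by (auto simp: Wv_def path_double_star_def)
  then have "\<phi> ` {Center_v, w} \<in> F" if "w \<in> Wv" for w using that \<phi>(1) by blast
  then have v: "star (\<phi> Center_v) (\<phi> ` Wv) \<subseteq> F" by (auto simp: star_def)
  have nin': "\<phi> Center_u \<notin> \<phi> ` Wu" "\<phi> Center_v \<notin> \<phi> ` Wv" "\<phi> Center_u \<notin> \<phi> ` Wv"
    using nin inj_on_image_mem_iff[OF \<phi>(2)] W by blast+
  have "\<phi> Center_u < n" "\<phi> Center_v < n" "\<phi> ` Wu \<subseteq> {..<n}" "\<phi> ` Wv \<subseteq> {..<n}"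
    using W \<phi>(3) by auto
  then have stars: "star (\<phi> Center_u) (\<phi> ` Wu) \<in> stars n k"
    "star (\<phi> Center_v) (\<phi> ` Wv) \<in> stars n k"
    unfolding stars_def mem_Collect_eq using c nin' by metis+
  have "\<phi> Center_u \<noteq> \<phi> Center_v" using \<phi>(2) W inj_onD[OF \<phi>(2), of Center_u Center_v] by auto
  then have "e \<notin> star (\<phi> Center_u) (\<phi> ` Wu) \<or> e \<notin> star (\<phi> Center_v) (\<phi> ` Wv)"
    using nin'(3) by (auto simp: star_def doubleton_eq_iff)
  then show ?thesis using u v stars by blast
qed

section \<open>Enforcer's box game\<close>

text \<open>\<open>L\<close> is the set of boxes still alive, \<open>f\<close> the level of each. Raising a box of level \<open>l\<close> pays for
  destroying \<open>t\<close> boxes of level at most \<open>l\<close>. If there are fewer than \<open>t\<close> such boxes, all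
  survivors end up above level \<open>l\<close>; the lower bound \<open>\<mu>\<close> for the levels records this gain.\<close>

definition reserve :: "nat \<Rightarrow> nat \<Rightarrow> nat \<Rightarrow> 'i set \<Rightarrow> ('i \<Rightarrow> nat) \<Rightarrow> bool" where
  "reserve m t D L f \<longleftrightarrow> (\<exists>\<mu>\<le>m. (\<forall>i\<in>L. \<mu> \<le> f i) \<and>
     (m + D) * (t + 1) ^ m \<le> (\<Sum>i\<in>L. (t + 1) ^ f i) + \<mu> * (t + 1) ^ m)"

text \<open>Further Avoider elements only raise levels, so claiming many at once does Enforcer no
  harm.\<close>

lemma reserve_mono:
  assumes "reserve m t D L f" "\<And>i. i \<in> L \<Longrightarrow> f i \<le> g i"
  shows "reserve m t D L g"
proof -
  obtain \<mu> where \<mu>: "\<mu> \<le> m" "\<forall>i\<in>L. \<mu> \<le> f i"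
    "(m + D) * (t + 1) ^ m \<le> (\<Sum>i\<in>L. (t + 1) ^ f i) + \<mu> * (t + 1) ^ m"
    using assms(1) by (auto simp: reserve_def)
  moreover have "(\<Sum>i\<in>L. (t + 1) ^ f i) \<le> (\<Sum>i\<in>L. (t + 1) ^ g i)"
    using assms(2) by (intro sum_mono power_increasing) auto
  ultimately show ?thesis unfolding reserve_def using assms(2)
    by (intro exI[of _ \<mu>]) (auto intro: le_trans)
qed

lemma sum_power_le:
  fixes f :: "'i \<Rightarrow> nat"
  assumes "\<And>i. i \<in> K \<Longrightarrow> f i < m"
  shows "(\<Sum>i\<in>K. (t + 1) ^ f i) \<le> card K * (t + 1) ^ (m - 1)"
proof -
  have "(\<Sum>i\<in>K. (t + 1) ^ f i) \<le> (\<Sum>i\<in>K. (t + 1) ^ (m - 1))"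
    using assms by (intro sum_mono power_increasing) fastforce+
  then show ?thesis by simp
qed

text \<open>As \<mu> \<le> m, the weights alone must carry \<open>D * (t + 1) ^ m\<close>, and each
  is at most \<open>(t + 1) ^ (m - 1)\<close> while all levels are below \<open>m\<close>. So the
  boxes cannot run out before one reaches level \<open>m\<close>.\<close>

lemma reserve_card:
  assumes "reserve m t D L f" "\<And>i. i \<in> L \<Longrightarrow> f i < m" "1 \<le> m"
  shows "D * (t + 1) \<le> card L"
proof -
  obtain \<mu> where \<mu>: "\<mu> \<le> m"
    "(m + D) * (t + 1) ^ m \<le> (\<Sum>i\<in>L. (t + 1) ^ f i) + \<mu> * (t + 1) ^ m"
    using assms(1) by (auto simp: reserve_def)
  have e: "(t + 1) ^ m = (t + 1) * (t + 1) ^ (m - 1)" using assms(3) by (cases m) auto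
  have "\<mu> * (t + 1) ^ m \<le> m * (t + 1) ^ m" using \<mu>(1) by simp
  then have "D * (t + 1) ^ m \<le> (\<Sum>i\<in>L. (t + 1) ^ f i)"
    using \<mu>(2) unfolding add_mult_distrib by linarith
  also have "\<dots> \<le> card L * (t + 1) ^ (m - 1)" using sum_power_le[OF assms(2)] .
  finally have "D * (t + 1) * (t + 1) ^ (m - 1) \<le> card L * (t + 1) ^ (m - 1)"
    by (simp only: e mult.assoc)
  then show ?thesis by simp
qed

lemma reserve_initial:
  assumes "(m + D) * (t + 1) ^ m \<le> card L"
  shows "reserve m t D L f"
proof -
  have "card L \<le> (\<Sum>i\<in>L. (t + 1) ^ f i)"
    using sum_mono[of L "\<lambda>_. 1" "\<lambda>i. (t + 1) ^ f i"] by simp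
  then show ?thesis unfolding reserve_def using assms by (intro exI[of _ 0]) auto
qed

text \<open>A box below level \<open>m\<close> weighs at most \<open>(t + 1) ^ m\<close>, so one
  unit of \<open>D\<close> pays for it. This covers boxes that become unusable because their vertex
  is a leaf of the first star.\<close>

lemma reserve_remove:
  assumes "reserve m t (D + c) L f" "\<And>i. i \<in> L \<Longrightarrow> f i < m" "finite L" "card J \<le> c" "finite J"
  shows "reserve m t D (L - J) f"
proof -
  obtain \<mu> where \<mu>: "\<mu> \<le> m" "\<forall>i\<in>L. \<mu> \<le> f i"
    "(m + (D + c)) * (t + 1) ^ m \<le> (\<Sum>i\<in>L. (t + 1) ^ f i) + \<mu> * (t + 1) ^ m"
    using assms(1) by (auto simp: reserve_def)
  have "(\<Sum>i\<in>L \<inter> J. (t + 1) ^ f i) \<le> card (L \<inter> J) * (t + 1) ^ (m - 1)"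
    using assms(2) by (intro sum_power_le) auto
  also have "\<dots> \<le> c * (t + 1) ^ m"
    using assms(4,5) card_mono[of J "L \<inter> J"] by (intro mult_mono power_increasing) auto
  finally have "(\<Sum>i\<in>L \<inter> J. (t + 1) ^ f i) \<le> c * (t + 1) ^ m" .
  moreover have "(\<Sum>i\<in>L. (t + 1) ^ f i) = (\<Sum>i\<in>L \<inter> J. (t + 1) ^ f i) + (\<Sum>i\<in>L - J. (t + 1) ^ f i)"
    using sum.Int_Diff[OF assms(3)] .
  ultimately show ?thesis unfolding reserve_def using \<mu>
    by (intro exI[of _ \<mu>]) (auto simp: add_mult_distrib)
qed

text \<open>The base \<open>t + 1\<close> makes a rise from level \<open>l\<close> to
  \<open>l + 1\<close> gain \<open>t * (t + 1) ^ l\<close>, the weight of \<open>t\<close> boxes of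
  level \<open>l\<close>. If fewer than \<open>t\<close> other boxes are that low, the loss is still
  at most \<open>(t + 1) ^ m\<close> and is made up by raising \<mu>. As \<mu> \<le> m, this happens
  at most \<open>m\<close> times, which the summand \<open>m\<close> in \<open>m + D\<close>
  prepays.\<close>

lemma reserve_step:
  assumes res: "reserve m t D L f" and fin: "finite L" and lt: "\<And>j. j \<in> L \<Longrightarrow> f j < m"
    and m: "1 \<le> m" and D: "1 \<le> D"
    and i: "i \<in> L" "f i < f' i" and f': "\<And>j. j \<in> L \<Longrightarrow> f j \<le> f' j \<and> f' j < m"
  shows "\<exists>K\<subseteq>L. card K = t \<and> reserve m t D (L - K) f'"
proof -
  define g where "g = f(i := Suc (f i))"
  let ?w = "\<lambda>j. (t + 1) ^ f j"
  obtain \<mu> where \<mu>: "\<mu> \<le> m" "\<forall>i\<in>L. \<mu> \<le> f i" "(m + D) * (t + 1) ^ m \<le> sum ?w L + \<mu> * (t + 1) ^ m"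
    using res by (auto simp: reserve_def)
  define M where "M = {j\<in>L - {i}. f j \<le> f i}"
  have cL: "t \<le> card (L - {i})"
  proof -
    have "1 * (t + 1) \<le> D * (t + 1)" using D by (intro mult_right_mono) auto
    also have "\<dots> \<le> card L" using reserve_card[OF res lt m] by simp
    finally show ?thesis using i fin by simp
  qed
  have sumg: "(\<Sum>j\<in>L - K. (t + 1) ^ g j) + sum ?w K = sum ?w L + t * (t + 1) ^ f i"
    if K: "K \<subseteq> L - {i}" for K
  proof -
    have "L - K = insert i (L - K - {i})" using K i by auto
    then have 1: "(\<Sum>j\<in>L - K. h j) = h i + (\<Sum>j\<in>L - K - {i}. h j)" for h :: "'a \<Rightarrow> nat"
      using fin by (metis Diff_iff finite_Diff insertI1 sum.insert singletonI)
    have "(\<Sum>j\<in>L - K - {i}. (t + 1) ^ g j) = (\<Sum>j\<in>L - K - {i}. ?w j)"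
      by (intro sum.cong) (auto simp: g_def)
    then have "(\<Sum>j\<in>L - K. (t + 1) ^ g j) = sum ?w (L - K) + t * (t + 1) ^ f i"
      using 1[of "\<lambda>j. (t + 1) ^ g j"] 1[of ?w] by (simp add: g_def)
    moreover have "sum ?w L = sum ?w (L - K) + sum ?w K"
      using K fin by (intro sum.subset_diff) auto
    ultimately show ?thesis by simp
  qed
  have "\<exists>K\<subseteq>L - {i}. card K = t \<and> reserve m t D (L - K) g"
  proof (cases "t \<le> card M")
    case True
    then obtain K where K: "K \<subseteq> M" "card K = t" by (meson obtain_subset_with_card_n)
    then have KL: "K \<subseteq> L - {i}" by (auto simp: M_def)
    have "sum ?w K \<le> (\<Sum>j\<in>K. (t + 1) ^ f i)"
      using K by (intro sum_mono power_increasing) (auto simp: M_def)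
    then have "sum ?w K \<le> t * (t + 1) ^ f i" using K(2) by simp
    then have "sum ?w L \<le> (\<Sum>j\<in>L - K. (t + 1) ^ g j)" using sumg[OF KL] by simp
    moreover have "\<forall>j\<in>L - K. \<mu> \<le> g j" using \<mu>(2) i by (auto simp: g_def le_SucI)
    ultimately have "reserve m t D (L - K) g"
      unfolding reserve_def using \<mu> by (intro exI[of _ \<mu>]) auto
    then show ?thesis using KL K by blast
  next
    case False
    \<comment> \<open>\<open>K\<close> swallows all of \<open>M\<close>, so every survivor,
      including the raised \<open>i\<close>, has level at least \<open>Suc (f i)\<close>, the new
      lower bound.\<close>
    then obtain K where K: "M \<subseteq> K" "K \<subseteq> L - {i}" "card K = t"
      using cL exists_subset_between[of M t "L - {i}"] fin by (auto simp: M_def)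
    have "sum ?w K \<le> card K * (t + 1) ^ (m - 1)" using K(2) lt by (intro sum_power_le) auto
    also have "\<dots> \<le> (t + 1) * (t + 1) ^ (m - 1)" using K(3) by simp
    also have "\<dots> = (t + 1) ^ m" using m by (cases m) auto
    finally have "sum ?w L \<le> (\<Sum>j\<in>L - K. (t + 1) ^ g j) + (t + 1) ^ m"
      using sumg[OF K(2)] by linarith
    moreover have "(\<mu> + 1) * (t + 1) ^ m \<le> Suc (f i) * (t + 1) ^ m"
      using \<mu>(2) i by (intro mult_right_mono) auto
    ultimately have "(m + D) * (t + 1) ^ m \<le>
        (\<Sum>j\<in>L - K. (t + 1) ^ g j) + Suc (f i) * (t + 1) ^ m"
      using \<mu>(3) unfolding add_mult_distrib by linarith
    moreover have "\<forall>j\<in>L - K. Suc (f i) \<le> g j" using K(1) by (auto simp: g_def M_def)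
    moreover have "Suc (f i) \<le> m" using lt i by (simp add: Suc_leI)
    ultimately have "reserve m t D (L - K) g" unfolding reserve_def by blast
    then show ?thesis using K by blast
  qed
  then obtain K where "K \<subseteq> L - {i}" "card K = t" "reserve m t D (L - K) g" by blast
  moreover from this(3) have "reserve m t D (L - K) f'"
    using f' i by (intro reserve_mono[of m t D "L - K" g f']) (auto simp: g_def)
  ultimately show ?thesis by blast
qed

text \<open>The boxes \<open>B A i\<close> may shrink as Avoider's set \<open>A\<close> grows, and may overlap; the private parts
  \<open>C i\<close> make sure that destroying a box costs many elements. \<open>P\<close> is a partition of the boxes into
  classes that are played independently of each other, and \<open>A\<^sub>0\<close> is Avoider's set at the
  beginning.\<close>

locale box_game =
  fixes E :: "'e set" and I :: "'i set" and P :: "'i set set"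
    and B :: "'e set \<Rightarrow> 'i \<Rightarrow> 'e set" and C :: "'i \<Rightarrow> 'e set" and lev :: "'e set \<Rightarrow> 'i \<Rightarrow> nat"
    and m t D q b :: nat and \<F> :: "'e set set" and A\<^sub>0 :: "'e set"
  assumes finE: "finite E" and finI: "finite I"
    and lev_mono: "\<And>A A' i. A \<subseteq> A' \<Longrightarrow> A' \<subseteq> E \<Longrightarrow> i \<in> I \<Longrightarrow> lev A i \<le> lev A' i"
    and B_anti: "\<And>A A' i. A \<subseteq> A' \<Longrightarrow> i \<in> I \<Longrightarrow> B A' i \<subseteq> B A i"
    and lev_less: "\<And>A A' i e. A \<subseteq> A' \<Longrightarrow> A' \<subseteq> E \<Longrightarrow> i \<in> I \<Longrightarrow> e \<in> B A i \<Longrightarrow> e \<notin> A \<Longrightarrow> e \<in> A' \<Longrightarrow>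
      lev A i < lev A' i"
    and C_sub: "\<And>A i. i \<in> I \<Longrightarrow> C i \<subseteq> B A i"
    and C_disj: "\<And>A i j. i \<in> I \<Longrightarrow> j \<in> I \<Longrightarrow> i \<noteq> j \<Longrightarrow> C i \<inter> B A j = {}"
    and C_card: "\<And>i. i \<in> I \<Longrightarrow> q \<le> card (C i)"
    and C_lev: "\<And>A i. A \<subseteq> E \<Longrightarrow> i \<in> I \<Longrightarrow> card (C i \<inter> A) \<le> lev A i"
    and B_E: "\<And>A i. i \<in> I \<Longrightarrow> B A i \<subseteq> E"
    and b_le: "b \<le> t * (q - m)" and mq: "m \<le> q" and m: "1 \<le> m" and D: "1 \<le> D"
    and P: "I \<subseteq> \<Union>P" "P \<noteq> {}" "\<And>c c'. c \<in> P \<Longrightarrow> c' \<in> P \<Longrightarrow> c \<noteq> c' \<Longrightarrow> c \<inter> c' = {}"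
    and terminal: "\<And>A R L i. A\<^sub>0 \<subseteq> A \<Longrightarrow> A \<subseteq> E \<Longrightarrow> R \<subseteq> E - A \<Longrightarrow> L \<subseteq> I \<Longrightarrow>
      (\<And>j. j \<in> L \<Longrightarrow> B A j - A \<subseteq> R) \<Longrightarrow>
      (\<And>c. c \<in> P \<Longrightarrow> reserve m t D (L \<inter> c) (lev A)) \<Longrightarrow>
      (\<And>c. c \<in> P \<Longrightarrow> D * (t + 1) \<le> card (L \<inter> c)) \<Longrightarrow>
      i \<in> L \<Longrightarrow> m \<le> lev A i \<Longrightarrow> enforcer_wins_enforcer_moves \<F> b A R"
begin

lemma finite_C: "i \<in> I \<Longrightarrow> finite (C i)"
  using C_sub[of i "{}"] B_E[of i "{}"] finE by (meson finite_subset)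

lemma card_C_free:
  assumes "i \<in> I" "A \<subseteq> E" "lev A i < m"
  shows "q - m \<le> card (C i - A)" "C i - A \<noteq> {}"
proof -
  have "card (C i - A) = card (C i) - card (C i \<inter> A)"
    using finite_C[OF assms(1)] by (simp add: card_Diff_subset_Int)
  moreover have "card (C i \<inter> A) < m" using C_lev[OF assms(2,1)] assms(3) by simp
  ultimately have "q - m < card (C i - A)" using C_card[OF assms(1)] mq by linarith
  then show "q - m \<le> card (C i - A)" "C i - A \<noteq> {}" by (simp, metis card.empty not_less_zero)
qed

text \<open>Enforcer's invariant: the unclaimed elements are exactly those of living boxes, all
  levels are below \<open>m\<close>, and every class has its reserve. Each claim of Avoider then
  raises a box, and since boxes never run out, play must end in \<open>terminal\<close>.\<close>

theorem avoider_to_move: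
  assumes "A\<^sub>0 \<subseteq> A" "A \<subseteq> E" "L \<subseteq> I" "\<And>i. i \<in> L \<Longrightarrow> lev A i < m"
    "\<And>c. c \<in> P \<Longrightarrow> reserve m t D (L \<inter> c) (lev A)" "R = (\<Union>i\<in>L. B A i) - A"
  shows "enforcer_wins_avoider_moves \<F> b A R"
  using assms
proof (induction "card R" arbitrary: A L R rule: less_induct)
  case less
  note A = less.prems(1,2) and L = less.prems(3) and lt = less.prems(4)
    and res = less.prems(5) and R = less.prems(6)
  have finL: "finite L" using L finI finite_subset by blast
  have RE: "R \<subseteq> E - A" unfolding R using L B_E by blast
  have finR: "finite R" using RE finE by (meson finite_Diff finite_subset)
  have cardL: "D * (t + 1) \<le> card (L \<inter> c)" if "c \<in> P" for c
    using res[OF that] lt m by (intro reserve_card) auto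
  obtain c0 where c0: "c0 \<in> P" using P(2) by blast
  have "0 < card (L \<inter> c0)" using cardL[OF c0] D by (metis add_gr_0 less_le_trans mult_pos_pos
      zero_less_one)
  then obtain i0 where i0: "i0 \<in> L" by (metis IntE all_not_in_conv card.empty less_irrefl)
  show ?case
  proof (rule avoider_step)
    show "R \<noteq> {}" using card_C_free(2)[of i0 A] C_sub[of i0 A] i0 L A lt unfolding R by blast
    fix S assume "legal_move 1 R S"
    then have S: "S \<subseteq> R" "S \<noteq> {}" using finR \<open>R \<noteq> {}\<close>
      by (auto simp: legal_move_def card_gt_0_iff Suc_le_eq)
    define A' where "A' = A \<union> S"
    have A': "A\<^sub>0 \<subseteq> A'" "A \<subseteq> A'" "A' \<subseteq> E" using A S RE by (auto simp: A'_def)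
    have BR: "B A' j - A' \<subseteq> R - S" if "j \<in> L" for j
      using B_anti[OF A'(2), of j] that L unfolding R A'_def by blast
    have mono: "lev A j \<le> lev A' j" if "j \<in> L" for j using lev_mono[OF A'(2,3)] that L by blast
    have res': "reserve m t D (L \<inter> c) (lev A')" if "c \<in> P" for c
      using res[OF that] mono by (rule reserve_mono) auto
    show "enforcer_wins_enforcer_moves \<F> b (A \<union> S) (R - S)"
    proof (cases "\<exists>i\<in>L. m \<le> lev A' i")
      case True
      then obtain i where i: "i \<in> L" "m \<le> lev A' i" by blast
      have "enforcer_wins_enforcer_moves \<F> b A' (R - S)"
        using A'(1,3) _ L BR res' cardL i by (rule terminal) (use RE in \<open>auto simp: A'_def\<close>)
      then show ?thesis by (simp add: A'_def)
    next
      case False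
      then have lt': "lev A' i < m" if "i \<in> L" for i using that by auto
      \<comment> \<open>One element of \<open>S\<close> suffices: the class of its box pays for the
        \<open>t\<close> boxes destroyed now, and the other classes keep their reserve by
        monotonicity.\<close>
      obtain s i where s: "s \<in> S" "s \<in> B A i" "i \<in> L" "s \<notin> A"
        using S unfolding R by blast
      obtain c where c: "c \<in> P" "i \<in> c" using P(1) L s by blast
      have "lev A i < lev A' i" using s L A' by (intro lev_less[of A A' i s]) (auto simp: A'_def)
      then obtain K where K: "K \<subseteq> L \<inter> c" "card K = t" "reserve m t D (L \<inter> c - K) (lev A')"
        using reserve_step[OF res[OF c(1)], of i "lev A'"] finL lt lt' mono m D s c by auto
      define L' where "L' = L - K"
      define R' where "R' = (\<Union>i\<in>L'. B A' i) - A'"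
      have R'sub: "R' \<subseteq> R - S" unfolding R'_def L'_def using BR by blast
      have KL: "K \<subseteq> I" "finite K" using K L finL finite_subset[of K L] by auto
      \<comment> \<open>Private parts meet no other box and contain fewer than \<open>m\<close>
        Avoider elements each, so destroying \<open>K\<close> gives Enforcer at least
        \<open>t * (q - m)\<close> elements to claim.\<close>
      have "card (\<Union>i\<in>K. C i - A') = (\<Sum>i\<in>K. card (C i - A'))"
        using KL finite_C C_sub[of _ A'] C_disj[of _ _ A'] by (intro card_UN_disjoint) blast+
      also have "\<dots> \<ge> (\<Sum>i\<in>K. q - m)"
        using K(1) L lt' A' by (intro sum_mono card_C_free) auto
      finally have "b \<le> card (\<Union>i\<in>K. C i - A')" using K(2) b_le by simp
      also have "\<dots> \<le> card (R - S - R')"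
      proof (rule card_mono)
        show "finite (R - S - R')" using finR by blast
        show "(\<Union>i\<in>K. C i - A') \<subseteq> R - S - R'"
        proof
          fix e assume "e \<in> (\<Union>i\<in>K. C i - A')"
          then obtain j where j: "j \<in> K" "e \<in> C j" "e \<notin> A'" by blast
          have "e \<in> R - S" using j BR[of j] C_sub[of j A'] K(1) L by blast
          moreover have "e \<notin> B A' l" if "l \<in> L'" for l
            using C_disj[of j l A'] j that K(1) L by (auto simp: L'_def)
          ultimately show "e \<in> R - S - R'" by (auto simp: R'_def)
        qed
      qed
      finally have legal: "legal_move b (R - S) (R - S - R')" by (auto simp: legal_move_def)
      have "C i - A' \<noteq> {}" using s L lt' A' by (intro card_C_free) auto
      then have ne: "R - S \<noteq> {}" using BR[of i] C_sub[of i A'] s L by blast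
      have "R' \<subset> R" using R'sub S by blast
      then have less: "card R' < card R" using finR by (rule psubset_card_mono[rotated])
      have "enforcer_wins_avoider_moves \<F> b A' R'"
      proof (rule less.hyps[OF less A'(1,3)])
        show "L' \<subseteq> I" using L by (auto simp: L'_def)
        show "lev A' i < m" if "i \<in> L'" for i using lt' that by (auto simp: L'_def)
        show "R' = (\<Union>i\<in>L'. B A' i) - A'" by (simp add: R'_def)
        show "reserve m t D (L' \<inter> c') (lev A')" if c': "c' \<in> P" for c'
        proof (cases "c' = c")
          case True
          then have "L' \<inter> c' = L \<inter> c - K" by (auto simp: L'_def)
          then show ?thesis using K by simp
        next
          case False
          then have "L' \<inter> c' = L \<inter> c'" using P(3)[OF c' c(1)] K(1) by (auto simp: L'_def)
          then show ?thesis using res'[OF c'] by simp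
        qed
      qed
      moreover have "R' = R - S - (R - S - R')" using R'sub by blast
      ultimately have "enforcer_wins_enforcer_moves \<F> b A' (R - S)"
        using enforcer_step[OF ne legal, of \<F> A'] by simp
      then show ?thesis by (simp add: A'_def)
    qed
  qed
qed

text \<open>Entry into a box game after an arbitrary Avoider move: Enforcer establishes the
  invariant by claiming all that lies outside the boxes, which is legal if \<open>b\<close>
  unclaimed elements lie there.\<close>

theorem enforcer_to_move:
  assumes "A\<^sub>0 \<subseteq> A" "A \<subseteq> E" "R \<subseteq> E - A" "L \<subseteq> I" "\<And>j. j \<in> L \<Longrightarrow> B A j - A \<subseteq> R"
    "\<And>c. c \<in> P \<Longrightarrow> reserve m t D (L \<inter> c) (lev A)"
    "\<And>c. c \<in> P \<Longrightarrow> D * (t + 1) \<le> card (L \<inter> c)"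
    "R \<noteq> {}" "b \<le> card (R - (\<Union>i\<in>L. B A i))"
  shows "enforcer_wins_enforcer_moves \<F> b A R"
proof (cases "\<exists>i\<in>L. m \<le> lev A i")
  case True
  then obtain i where i: "i \<in> L" "m \<le> lev A i" by blast
  show ?thesis using assms(1-7) i by (rule terminal)
next
  case False
  then have "enforcer_wins_avoider_moves \<F> b A ((\<Union>i\<in>L. B A i) - A)"
    using assms by (intro avoider_to_move[where L = L]) auto
  moreover have "R - (R - (\<Union>i\<in>L. B A i)) = (\<Union>i\<in>L. B A i) - A" using assms(3,5) by blast
  moreover have "legal_move b R (R - (\<Union>i\<in>L. B A i))" using assms(9) by (auto simp: legal_move_def)
  ultimately show ?thesis using enforcer_step[of R b "R - (\<Union>i\<in>L. B A i)" \<F> A] assms(8) by simp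
qed

end

section \<open>Finding double stars\<close>

definition nbrs :: "'v set set \<Rightarrow> 'v \<Rightarrow> 'v set" where
  "nbrs A x = {y. {x, y} \<in> A}"

abbreviation K\<^sub>E :: "nat \<Rightarrow> nat set set" where "K\<^sub>E n \<equiv> edges (complete_graph n)"

lemma K\<^sub>E_iff: "{x, y} \<in> K\<^sub>E n \<longleftrightarrow> x < n \<and> y < n \<and> x \<noteq> y"
  by (auto simp: complete_graph_def card_2_iff doubleton_eq_iff)

lemma nbrs_K\<^sub>E: "A \<subseteq> K\<^sub>E n \<Longrightarrow> y \<in> nbrs A x \<Longrightarrow> x < n \<and> y < n \<and> x \<noteq> y"
  using K\<^sub>E_iff[of x y n] by (auto simp: nbrs_def)

lemma finite_nbrs: "A \<subseteq> K\<^sub>E n \<Longrightarrow> finite (nbrs A x)"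
  by (rule finite_subset[of _ "{..<n}"]) (auto dest: nbrs_K\<^sub>E)

lemma card_Int_star: "card (A \<inter> star x Z) = card (nbrs A x \<inter> Z)"
proof -
  have "A \<inter> star x Z = star x (nbrs A x \<inter> Z)" by (auto simp: star_def nbrs_def)
  then show ?thesis by simp
qed

lemma double_star_in:
  assumes A: "A \<subseteq> K\<^sub>E n" and "{u, v} \<in> A" "U \<subseteq> nbrs A u" "V \<subseteq> nbrs A v"
    "U \<inter> V = {}" "v \<notin> U" "u \<notin> V" "k - 1 \<le> card U" "k - 1 \<le> card V"
  shows "\<exists>F\<in>copies (double_star k) (complete_graph n). F \<subseteq> A"
proof -
  obtain U' V' where U': "U' \<subseteq> U" "card U' = k - 1" and V': "V' \<subseteq> V" "card V' = k - 1"
    by (meson assms(8,9) obtain_subset_with_card_n)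
  have fin: "finite U'" "finite V'"
    using U' V' assms finite_nbrs[OF A] by (meson finite_subset)+
  obtain h where h: "bij_betw h {1..k-1} U'" using ex_bij_betw_nat_finite_1[OF fin(1)] U' by auto
  obtain g where g: "bij_betw g {1..k-1} V'" using ex_bij_betw_nat_finite_1[OF fin(2)] V' by auto
  define \<phi> where "\<phi> x = (case x of Center_u \<Rightarrow> u | Center_v \<Rightarrow> v | Middle_w \<Rightarrow> u
    | Leaf_u i \<Rightarrow> h i | Leaf_v i \<Rightarrow> g i)" for x
  have hU: "h i \<in> nbrs A u" "h i \<in> U" if "i \<in> {1..k-1}" for i
    using bij_betwE[OF h] that U' assms(3) by blast+
  have gV: "g i \<in> nbrs A v" "g i \<in> V" if "i \<in> {1..k-1}" for i
    using bij_betwE[OF g] that V' assms(4) by blast+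
  have uv: "u \<noteq> v" and ltuv: "u < n" "v < n" using assms(2) A K\<^sub>E_iff[of u v n] by auto
  have inj: "inj_on h {1..k-1}" "inj_on g {1..k-1}" using h g by (auto simp: bij_betw_def)
  have ne: "h i \<noteq> u" "h i \<noteq> v" "g i \<noteq> u" "g i \<noteq> v" and lt: "h i < n" "g i < n"
    if "i \<in> {1..k-1}" for i
    using hU[OF that] gV[OF that] nbrs_K\<^sub>E[OF A] assms(6,7) by blast+
  have hg: "h i \<noteq> g j" if "i \<in> {1..k-1}" "j \<in> {1..k-1}" for i j
    using hU(2)[OF that(1)] gV(2)[OF that(2)] assms(5) by auto
  have edges: "(`) \<phi> ` edges (double_star k) \<subseteq> A"
    using assms(2) hU(1) gV(1) by (fastforce simp: double_star_def \<phi>_def nbrs_def)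
  have "inj_on \<phi> (verts (double_star k))"
    unfolding double_star_def fst_conv
    by (rule inj_onI, elim UnE insertE imageE emptyE)
      (simp_all add: \<phi>_def uv ne hg uv[THEN not_sym] ne[THEN not_sym] hg[THEN not_sym]
        inj_on_eq_iff[OF inj(1)] inj_on_eq_iff[OF inj(2)] del: atLeastAtMost_iff)
  moreover have "\<phi> ` verts (double_star k) \<subseteq> {..<n}"
    using ltuv lt by (auto simp: double_star_def \<phi>_def)
  ultimately have "(`) \<phi> ` edges (double_star k) \<in> copies (double_star k) (complete_graph n)"
    using edges A unfolding copies_def mem_Collect_eq complete_graph_def fst_conv snd_conv
    by (intro exI[of _ \<phi>]) auto
  then show ?thesis using edges by blast
qed

lemma path_double_star_in:
  assumes A: "A \<subseteq> K\<^sub>E n" and "{u, w} \<in> A" "{v, w} \<in> A" "u \<noteq> v" "U \<subseteq> nbrs A u" "V \<subseteq> nbrs A v"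
    "U \<inter> V = {}" "v \<notin> U" "w \<notin> U" "u \<notin> V" "w \<notin> V" "k - 1 \<le> card U" "k - 1 \<le> card V"
  shows "\<exists>F\<in>copies (path_double_star k) (complete_graph n). F \<subseteq> A"
proof -
  obtain U' V' where U': "U' \<subseteq> U" "card U' = k - 1" and V': "V' \<subseteq> V" "card V' = k - 1"
    by (meson assms(12,13) obtain_subset_with_card_n)
  have fin: "finite U'" "finite V'"
    using U' V' assms finite_nbrs[OF A] by (meson finite_subset)+
  obtain h where h: "bij_betw h {1..k-1} U'" using ex_bij_betw_nat_finite_1[OF fin(1)] U' by auto
  obtain g where g: "bij_betw g {1..k-1} V'" using ex_bij_betw_nat_finite_1[OF fin(2)] V' by auto
  define \<phi> where "\<phi> x = (case x of Center_u \<Rightarrow> u | Center_v \<Rightarrow> v | Middle_w \<Rightarrow> w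
    | Leaf_u i \<Rightarrow> h i | Leaf_v i \<Rightarrow> g i)" for x
  have hU: "h i \<in> nbrs A u" "h i \<in> U" if "i \<in> {1..k-1}" for i
    using bij_betwE[OF h] that U' assms(5) by blast+
  have gV: "g i \<in> nbrs A v" "g i \<in> V" if "i \<in> {1..k-1}" for i
    using bij_betwE[OF g] that V' assms(6) by blast+
  have uv: "u \<noteq> v" "u \<noteq> w" "v \<noteq> w" and ltuv: "u < n" "v < n" "w < n"
    using assms(2,3,4) A K\<^sub>E_iff[of u w n] K\<^sub>E_iff[of v w n] by auto
  have inj: "inj_on h {1..k-1}" "inj_on g {1..k-1}" using h g by (auto simp: bij_betw_def)
  have ne: "h i \<noteq> u" "h i \<noteq> v" "h i \<noteq> w" "g i \<noteq> u" "g i \<noteq> v" "g i \<noteq> w"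
    and lt: "h i < n" "g i < n" if "i \<in> {1..k-1}" for i
    using hU[OF that] gV[OF that] nbrs_K\<^sub>E[OF A] assms(8-11) by blast+
  have hg: "h i \<noteq> g j" if "i \<in> {1..k-1}" "j \<in> {1..k-1}" for i j
    using hU(2)[OF that(1)] gV(2)[OF that(2)] assms(7) by auto
  have edges: "(`) \<phi> ` edges (path_double_star k) \<subseteq> A"
    using assms(2,3) hU(1) gV(1) by (fastforce simp: path_double_star_def \<phi>_def nbrs_def)
  have "inj_on \<phi> (verts (path_double_star k))"
    unfolding path_double_star_def fst_conv
    by (rule inj_onI, elim UnE insertE imageE emptyE)
      (simp_all add: \<phi>_def uv ne hg uv[THEN not_sym] ne[THEN not_sym] hg[THEN not_sym]
        inj_on_eq_iff[OF inj(1)] inj_on_eq_iff[OF inj(2)] del: atLeastAtMost_iff)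
  moreover have "\<phi> ` verts (path_double_star k) \<subseteq> {..<n}"
    using ltuv lt by (auto simp: path_double_star_def \<phi>_def)
  ultimately have "(`) \<phi> ` edges (path_double_star k) \<in> copies (path_double_star k) (complete_graph n)"
    using edges A unfolding copies_def mem_Collect_eq complete_graph_def fst_conv snd_conv
    by (intro exI[of _ \<phi>]) auto
  then show ?thesis using edges by blast
qed

text \<open>At most \<open>d * n\<close> edges have an end of degree below \<open>d\<close>, so more
  than \<open>n\<close> others remain. Map each to its smaller endpoint: two of them share it, and
  it becomes the midpoint \<open>w\<close>.\<close>

lemma dense_graph_high_degree_path:
  assumes A: "A \<subseteq> K\<^sub>E n" and "(d + 1) * n < card A"
  shows "\<exists>u v w. u \<noteq> v \<and> {u, w} \<in> A \<and> {v, w} \<in> A \<and>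
    d \<le> card (nbrs A u) \<and> d \<le> card (nbrs A v) \<and> d \<le> card (nbrs A w)"
proof -
  define low where "low = {x. x < n \<and> card (nbrs A x) < d}"
  define bad where "bad = (\<Union>x\<in>low. star x (nbrs A x))"
  have finA: "finite A" using A finite_edges_complete_graph finite_subset by blast
  have "card bad \<le> (\<Sum>x\<in>low. card (star x (nbrs A x)))"
    unfolding bad_def by (rule card_UN_le) (simp add: low_def)
  also have "\<dots> \<le> (\<Sum>x\<in>low. d)" by (rule sum_mono) (auto simp: low_def)
  also have "\<dots> \<le> n * d" using card_mono[of "{..<n}" low] by (auto simp: low_def)
  finally have "card bad \<le> d * n" by (simp add: mult.commute)
  moreover have "card A - card bad \<le> card (A - bad)"
    by (rule diff_card_le_card_Diff) (simp add: bad_def low_def star_def finite_nbrs[OF A])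
  ultimately have gt: "n < card (A - bad)" using assms(2) by (simp add: algebra_simps)
  have two: "\<exists>x y. e = {x, y} \<and> x < y \<and> y < n" if "e \<in> A" for e
  proof -
    have "e \<in> K\<^sub>E n" using that A by blast
    then obtain x y where "e = {x, y}" "x \<noteq> y" "x < n" "y < n"
      by (auto simp: complete_graph_def card_2_iff)
    then show ?thesis by (metis insert_commute linorder_neqE_nat)
  qed
  have "Min ` (A - bad) \<subseteq> {..<n}" using two by fastforce
  then have "card (Min ` (A - bad)) \<le> n" by (metis card_lessThan card_mono finite_lessThan)
  then have "\<not> inj_on Min (A - bad)" using gt card_image[of Min "A - bad"] by linarith
  then obtain e1 e2 where e: "e1 \<in> A - bad" "e2 \<in> A - bad" "Min e1 = Min e2" "e1 \<noteq> e2"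
    by (auto simp: inj_on_def)
  obtain w1 u where u: "e1 = {w1, u}" "w1 < u" "u < n" using two e by blast
  obtain w2 v where v: "e2 = {w2, v}" "w2 < v" "v < n" using two e by blast
  have w: "w1 = w2" using e(3) u v by (simp add: min_def)
  have deg: "d \<le> card (nbrs A x)" if "{x, y} \<in> A - bad" "x < n" for x y
    using that by (force simp: bad_def low_def star_def nbrs_def)
  have "d \<le> card (nbrs A u)" using deg[of u w1] e(1) u by (simp add: insert_commute)
  moreover have "d \<le> card (nbrs A v)" using deg[of v w2] e(2) v by (simp add: insert_commute)
  moreover have "d \<le> card (nbrs A w1)" using deg[of w1 u] e(1) u by simp
  moreover have "u \<noteq> v" using u v w e(4) by blast
  moreover have "{u, w1} \<in> A" "{v, w1} \<in> A"
    using e u v w by (auto simp: insert_commute)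
  ultimately show ?thesis by blast
qed

text \<open>Greedy choice: for positive \<open>k\<close>, of the \<open>2 * k + 1\<close> neighbours
  of \<open>v\<close> at most \<open>3 + (k - 1)\<close> are excluded by \<open>W\<close> and the
  leaves of \<open>u\<close>, which leaves \<open>k - 1\<close>.\<close>

lemma disjoint_leaf_sets:
  assumes A: "A \<subseteq> K\<^sub>E n" and "2 * k + 1 \<le> card (nbrs A u)" "2 * k + 1 \<le> card (nbrs A v)" "finite W" "card W \<le> 3"
  shows "\<exists>U V. U \<subseteq> nbrs A u - W \<and> V \<subseteq> nbrs A v - W \<and> U \<inter> V = {} \<and> k - 1 \<le> card U \<and> k - 1 \<le> card V"
proof -
  have "k - 1 \<le> card (nbrs A u - W)"
    using assms(2,5) diff_card_le_card_Diff[OF assms(4), of "nbrs A u"] by linarith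
  then obtain U where U: "U \<subseteq> nbrs A u - W" "card U = k - 1" by (meson obtain_subset_with_card_n)
  have finU: "finite U" using U(1) finite_nbrs[OF A] by (meson finite_Diff finite_subset)
  have "card (nbrs A v) - card (W \<union> U) \<le> card (nbrs A v - (W \<union> U))"
    using assms(4) finU by (intro diff_card_le_card_Diff) auto
  moreover have "card (W \<union> U) \<le> 3 + (k - 1)" using card_Un_le[of W U] assms(5) U(2) by linarith
  ultimately have "k - 1 \<le> card (nbrs A v - (W \<union> U))" using assms(3) by linarith
  then show ?thesis using U by (intro exI[of _ U] exI[of _ "nbrs A v - (W \<union> U)"]) auto
qed

lemma dense_double_star:
  assumes A: "A \<subseteq> K\<^sub>E n" and "(2 * k + 2) * n < card A"
  shows "\<exists>F\<in>copies (double_star k) (complete_graph n). F \<subseteq> A"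
    "\<exists>F\<in>copies (path_double_star k) (complete_graph n). F \<subseteq> A"
proof -
  obtain u v w where *: "u \<noteq> v" "{u, w} \<in> A" "{v, w} \<in> A" "2 * k + 1 \<le> card (nbrs A u)"
    "2 * k + 1 \<le> card (nbrs A v)" "2 * k + 1 \<le> card (nbrs A w)"
    using dense_graph_high_degree_path[OF A, of "2 * k + 1"] assms(2) by auto
  have W: "finite {u, v, w}" "card {u, v, w} \<le> 3" by (auto simp: card_insert_if)
  obtain U V where "U \<subseteq> nbrs A u - {u, v, w}" "V \<subseteq> nbrs A w - {u, v, w}" "U \<inter> V = {}"
    "k - 1 \<le> card U" "k - 1 \<le> card V"
    using disjoint_leaf_sets[OF A *(4,6) W] by blast
  then show "\<exists>F\<in>copies (double_star k) (complete_graph n). F \<subseteq> A"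
    using * by (intro double_star_in[OF A, of u w U V]) auto
  obtain U V where "U \<subseteq> nbrs A u - {u, v, w}" "V \<subseteq> nbrs A v - {u, v, w}" "U \<inter> V = {}"
    "k - 1 \<le> card U" "k - 1 \<le> card V"
    using disjoint_leaf_sets[OF A *(4,5) W] by blast
  then show "\<exists>F\<in>copies (path_double_star k) (complete_graph n). F \<subseteq> A"
    using * by (intro path_double_star_in[OF A, of u w v U V]) auto
qed

section \<open>Enforcer's strategy\<close>

lemma star_Int_star_disjoint:
  assumes "i \<noteq> j" "i \<notin> Z" "j \<notin> Y"
  shows "star i Y \<inter> star j Z = {}"
  using assms by (auto simp: star_def doubleton_eq_iff)

lemma finite_star [simp]: "finite Y \<Longrightarrow> finite (star x Y)"
  by (simp add: star_def)

lemma star_subset_K\<^sub>E: "x < n \<Longrightarrow> Y \<subseteq> {..<n} \<Longrightarrow> x \<notin> Y \<Longrightarrow> star x Y \<subseteq> K\<^sub>E n"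
  using K\<^sub>E_iff by (fastforce simp: star_def)

lemma reserve_weaken: "reserve m t D L f \<Longrightarrow> D' \<le> D \<Longrightarrow> reserve m t D' L f"
  unfolding reserve_def by (meson add_left_mono le_trans mult_le_mono1)

text \<open>Finds the one missing edge at a candidate with neighbours \<open>W\<close>. If the
  prescribed neighbour \<open>u\<close> is absent, it is the missing one; if \<open>u\<close> is in
  \<open>W\<close>, it uses up a leaf, which a fresh \<open>y\<close> replaces.\<close>

lemma star_completion:
  assumes "W \<subseteq> Z" "m \<le> card W" "u \<in> Z" "m < card Z" "1 \<le> m" "finite Z"
  shows "\<exists>y\<in>Z. u \<in> insert y W \<and> (\<exists>V\<subseteq>insert y W - {u}. m \<le> card V)"
proof (cases "u \<in> W")
  case True
  have finW: "finite W" using assms(1,6) finite_subset by blast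
  have "m - 1 \<le> card (W - {u})" using True assms(2) finW by simp
  then obtain T where T: "T \<subseteq> W - {u}" "card T = m - 1" by (meson obtain_subset_with_card_n)
  have finT: "finite T" using T(1) finW by (meson finite_Diff finite_subset)
  have "u \<notin> T" using T(1) by blast
  then have "card (insert u T) < card Z" using T(2) assms(4,5) finT by simp
  then obtain y where y: "y \<in> Z" "y \<notin> insert u T"
    using finT by (meson card_mono finite_insert leD subsetI)
  have "insert y T \<subseteq> insert y W - {u}" using T y by auto
  moreover have "m \<le> card (insert y T)" using y finT T(2) by simp
  ultimately show ?thesis using y True by blast
next
  case False
  then show ?thesis using assms(2,3) by (intro bexI[of _ u]) auto
qed

text \<open>\<open>q\<close> is the block size and \<open>D\<close> is
  \<open>8 * (2 * k + 2) + 1\<close>: by \<open>dense_double_star\<close> only Avoider graphs with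
  at most \<open>(2 * k + 2) * n \<le> 8 * (2 * k + 2) * q\<close> edges matter, and
  \<open>D\<close> stars of \<open>q\<close> edges exceed this by \<open>q\<close>.\<close>

locale enforcer_setting =
  fixes n q m k t b D :: nat
  assumes k: "3 \<le> k" and nq: "n \<le> 8 * q" and m1: "1 \<le> m" and mq: "m \<le> q"
    and b: "b \<le> t * (q - m)" and D: "D = 16 * k + 17"
begin

text \<open>As \<open>D + t \<le> D * (t + 1)\<close>, the stars have at least
  \<open>8 * (2 * k + 2) * q + q + t * q\<close> edges: the first part covers \<open>A\<close>, the
  last covers \<open>b\<close>, and \<open>q\<close> makes the inequality strict. Enforcer relies on
  this whenever he switches games.\<close>

lemma many_free_edges:
  assumes "finite L" "finite Y" "L \<inter> Y = {}" "q \<le> card Y" "D * (t + 1) \<le> card L"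
    "finite A" "card A \<le> (2 * k + 2) * n"
  shows "b < card ((\<Union>i\<in>L. star i Y) - A)"
proof -
  have "card (\<Union>i\<in>L. star i Y) = (\<Sum>i\<in>L. card (star i Y))"
  proof (rule card_UN_disjoint)
    show "\<forall>i\<in>L. \<forall>j\<in>L. i \<noteq> j \<longrightarrow> star i Y \<inter> star j Y = {}"
      using assms(3) by (intro ballI impI star_Int_star_disjoint) auto
  qed (use assms(1,2) in auto)
  then have c: "card (\<Union>i\<in>L. star i Y) = card L * card Y" by simp
  have "D * (t + 1) * q \<le> card L * card Y" using assms(4,5) by (rule mult_le_mono[rotated])
  moreover have "(D + t) * q \<le> D * (t + 1) * q" unfolding D by (intro mult_right_mono) auto
  moreover have "(2 * k + 2) * n \<le> (2 * k + 2) * (8 * q)" using nq by (rule mult_le_mono2)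
  moreover have "(D + t) * q = (2 * k + 2) * (8 * q) + q + t * q" unfolding D by algebra
  moreover have "b \<le> t * q" using b by (meson diff_le_self le_trans mult_le_mono2)
  ultimately have "b < card (\<Union>i\<in>L. star i Y) - card A"
    using assms(7) m1 mq unfolding c by linarith
  also have "\<dots> \<le> card ((\<Union>i\<in>L. star i Y) - A)" by (rule diff_card_le_card_Diff[OF assms(6)])
  finally show ?thesis .
qed

lemma enforcer_wins_or_sparse:
  assumes "A \<subseteq> K\<^sub>E n" "finite R" "H = double_star k \<or> H = path_double_star k"
    and "card A \<le> (2 * k + 2) * n \<Longrightarrow>
      enforcer_wins_enforcer_moves (copies H (complete_graph n)) b A R"
  shows "enforcer_wins_enforcer_moves (copies H (complete_graph n)) b A R"
proof (cases "card A \<le> (2 * k + 2) * n")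
  case False
  then have "\<exists>F\<in>copies H (complete_graph n). F \<subseteq> A"
    using assms(1,3) dense_double_star[of A n k] by auto
  then show ?thesis using enforcer_wins_if_claimed assms(2) by blast
qed (use assms(4) in blast)

text \<open>Leaving only \<open>e\<close> is legal if more than \<open>b\<close> edges are
  unclaimed, and the surviving stars provide them. This is why \<open>terminal\<close> comes with a
  lower bound on the number of boxes.\<close>

lemma enforcer_wins_if_completes:
  assumes A: "A \<subseteq> K\<^sub>E n" "R \<subseteq> K\<^sub>E n - A" and H: "H = double_star k \<or> H = path_double_star k"
    and e: "e \<in> A \<union> R" "\<exists>F\<in>copies H (complete_graph n). F \<subseteq> insert e A"
    and L: "finite L" "finite Y" "L \<inter> Y = {}" "q \<le> card Y" "D * (t + 1) \<le> card L"
    and R: "(\<Union>i\<in>L. star i Y) - A \<subseteq> R"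
  shows "enforcer_wins_enforcer_moves (copies H (complete_graph n)) b A R"
proof -
  have fin: "finite A" "finite R"
    using A finite_edges_complete_graph by (meson finite_Diff finite_subset)+
  obtain F where F: "F \<in> copies H (complete_graph n)" "F \<subseteq> insert e A" using e by blast
  show ?thesis
  proof (rule enforcer_wins_or_sparse[OF A(1) fin(2) H])
    assume "card A \<le> (2 * k + 2) * n"
    then have "b < card ((\<Union>i\<in>L. star i Y) - A)" using many_free_edges L fin by blast
    also have "\<dots> \<le> card R" using R fin by (intro card_mono)
    finally have "b < card R" .
    then show "enforcer_wins_enforcer_moves (copies H (complete_graph n)) b A R"
      using e(1) F fin enforcer_wins_if_threat[of e R F] enforcer_wins_if_claimed[of F]
      by (metis Un_iff insert_absorb)
  qed
qed

end

subsection \<open>Double stars\<close>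

text \<open>Second stage: Avoider already has a star with centre \<open>u\<close>, and the boxes are the stars
  from the vertices of \<open>I\<close> to \<open>Z\<close>.\<close>

lemma (in enforcer_setting) double_star_second_stage:
  assumes mk: "m = k - 1"
    and vert: "I \<subseteq> {..<n}" "Z \<subseteq> {..<n}" and u: "u \<in> Z" and Z: "Y \<subseteq> Z" "u \<notin> Y" "q \<le> card Y"
    and U: "U \<subseteq> nbrs A u" "k - 1 \<le> card U"
    and disj: "Z \<inter> U = {}" "I \<inter> Z = {}" "I \<inter> U = {}"
    and pos: "A \<subseteq> K\<^sub>E n" "R \<subseteq> K\<^sub>E n - A" "L \<subseteq> I" "\<And>j. j \<in> L \<Longrightarrow> star j Z - A \<subseteq> R"
    and res: "reserve m t D L (\<lambda>x. card (A \<inter> star x Z))" "D * (t + 1) \<le> card L"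
    and bR: "R \<noteq> {}" "b \<le> card (R - (\<Union>i\<in>L. star i Z))"
  shows "enforcer_wins_enforcer_moves (copies (double_star k) (complete_graph n)) b A R"
proof -
  let ?\<F> = "copies (double_star k) (complete_graph n)"
  have fin: "finite I" "finite Z" "finite Y" using vert Z(1) by (meson finite_lessThan finite_subset)+
  \<comment> \<open>A single class is left. Since \<open>u\<close> lies in \<open>Z\<close>, the
    edge linking a candidate to \<open>u\<close> counts towards the candidate's level.\<close>
  interpret box_game "K\<^sub>E n" I "{I}" "\<lambda>_ x. star x Z" "\<lambda>x. star x Y" "\<lambda>A x. card (A \<inter> star x Z)"
    m t D q b ?\<F> A
  proof
    show "finite (K\<^sub>E n)" by (rule finite_edges_complete_graph)
    show "card (A' \<inter> star i Z) \<le> card (A'' \<inter> star i Z)" if "A' \<subseteq> A''" for A' A'' i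
      using that fin by (intro card_mono) auto
    show "card (A' \<inter> star i Z) < card (A'' \<inter> star i Z)"
      if "A' \<subseteq> A''" "e \<in> star i Z" "e \<notin> A'" "e \<in> A''" for A' A'' i e
      using that fin by (intro psubset_card_mono) auto
    show "star i Y \<inter> star j Z = {}" if "i \<in> I" "j \<in> I" "i \<noteq> j" for i j
      using that disj(2) Z(1) by (intro star_Int_star_disjoint) auto
    show "card (star i Y \<inter> A') \<le> card (A' \<inter> star i Z)" for A' i
      using star_mono[OF Z(1), of i] fin by (intro card_mono) auto
    show "star i Z \<subseteq> K\<^sub>E n" if "i \<in> I" for i
      using that vert disj(2) by (intro star_subset_K\<^sub>E) auto
    show "1 \<le> D" by (simp add: D)
    fix A' R' L' i
    assume *: "A \<subseteq> A'" "A' \<subseteq> K\<^sub>E n" "R' \<subseteq> K\<^sub>E n - A'" "L' \<subseteq> I"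
      and BR: "\<And>j. j \<in> L' \<Longrightarrow> star j Z - A' \<subseteq> R'"
      and "\<And>c. c \<in> {I} \<Longrightarrow> reserve m t D (L' \<inter> c) (\<lambda>x. card (A' \<inter> star x Z))"
      and cL: "\<And>c. c \<in> {I} \<Longrightarrow> D * (t + 1) \<le> card (L' \<inter> c)"
      and i: "i \<in> L'" "m \<le> card (A' \<inter> star i Z)"
    have cZ: "m < card Z"
    proof -
      have "Suc (card Y) \<le> card Z"
        using Z u fin card_mono[of Z "insert u Y"] by simp
      then show ?thesis using Z(3) mq by linarith
    qed
    define W where "W = nbrs A' i \<inter> Z"
    have "m \<le> card W" using i(2) by (simp add: card_Int_star W_def)
    then obtain y V where y: "y \<in> Z" "u \<in> insert y W" and V: "V \<subseteq> insert y W - {u}" "m \<le> card V"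
      using star_completion[of W Z m u] u cZ m1 fin by (auto simp: W_def)
    let ?A = "insert {i, y} A'"
    have iI: "i \<in> I" using i * by auto
    have e: "{i, y} \<in> star i Z" using y by (auto simp: star_def)
    have "{i, y} \<in> A' \<union> R'" using e BR[OF i(1)] by blast
    moreover have "\<exists>F\<in>?\<F>. F \<subseteq> ?A"
    proof (rule double_star_in)
      have "star i Z \<subseteq> K\<^sub>E n" using iI vert disj(2) by (intro star_subset_K\<^sub>E) auto
      then show "?A \<subseteq> K\<^sub>E n" using *(2) e by blast
      show "{u, i} \<in> ?A" using y(2) by (auto simp: W_def nbrs_def insert_commute)
      show "U \<subseteq> nbrs ?A u" using U *(1) by (auto simp: nbrs_def)
      show "V \<subseteq> nbrs ?A i" using V by (auto simp: W_def nbrs_def)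
      have "V \<subseteq> Z" using V y by (auto simp: W_def)
      then show "U \<inter> V = {}" "i \<notin> U" "u \<notin> V" using disj V iI by auto
      show "k - 1 \<le> card U" "k - 1 \<le> card V" using U V mk by auto
    qed
    moreover have "finite L'" "L' \<inter> Y = {}" using * fin disj Z by (auto intro: finite_subset)
    moreover have "L' \<inter> I = L'" using * by auto
    then have "D * (t + 1) \<le> card L'" using cL[of I] by simp
    moreover have "(\<Union>i\<in>L'. star i Y) - A' \<subseteq> R'" using BR star_mono[OF Z(1)] by blast
    ultimately show "enforcer_wins_enforcer_moves ?\<F> b A' R'"
      using *(2,3) fin Z(3) by (intro enforcer_wins_if_completes[of A' R' _ "{i, y}" L' Y]) auto
  qed (use fin mq m1 b Z star_mono[OF Z(1)] in auto)
  have "L \<inter> I = L" using pos by auto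
  then show ?thesis using pos res bR by (intro enforcer_to_move[where L = L]) auto
qed

text \<open>Candidates in \<open>X\<^sub>1\<close> collect leaves in \<open>Y\<^sub>1\<close>, those
  in \<open>X\<^sub>2\<close> in \<open>X\<^sub>1 \<union> Y\<^sub>2\<close>; an edge linking two
  candidates is thus charged to its end in \<open>X\<^sub>2\<close>. Whichever class delivers the
  first centre, play goes on in the other. The edges between \<open>X\<^sub>1\<close> and
  \<open>Y\<^sub>2\<close> lie in no box and serve Enforcer's first move.\<close>

lemma (in enforcer_setting) double_star_first_stage:
  assumes mk: "m = k - 1"
    and vert: "X\<^sub>1 \<subseteq> {..<n}" "X\<^sub>2 \<subseteq> {..<n}" "Y\<^sub>1 \<subseteq> {..<n}" "Y\<^sub>2 \<subseteq> {..<n}"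
    and card: "card X\<^sub>1 = q" "card X\<^sub>2 = q" "card Y\<^sub>1 = q" "card Y\<^sub>2 = q"
    and disj: "X\<^sub>1 \<inter> X\<^sub>2 = {}" "X\<^sub>1 \<inter> Y\<^sub>1 = {}" "X\<^sub>1 \<inter> Y\<^sub>2 = {}" "X\<^sub>2 \<inter> Y\<^sub>1 = {}" "X\<^sub>2 \<inter> Y\<^sub>2 = {}" "Y\<^sub>1 \<inter> Y\<^sub>2 = {}"
    and q: "(m + (D + m)) * (t + 1) ^ m \<le> q"
  shows "enforcer_wins (double_star k) n b"
proof -
  let ?\<F> = "copies (double_star k) (complete_graph n)"
  have fin: "finite X\<^sub>1" "finite X\<^sub>2" "finite Y\<^sub>1" "finite Y\<^sub>2"
    using vert by (meson finite_lessThan finite_subset)+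
  define Z where "Z x = (if x \<in> X\<^sub>1 then Y\<^sub>1 else X\<^sub>1 \<union> Y\<^sub>2)" for x
  define Y where "Y x = (if x \<in> X\<^sub>1 then Y\<^sub>1 else Y\<^sub>2)" for x
  have YZ: "Y x \<subseteq> Z x" for x by (auto simp: Y_def Z_def)
  have finZ: "finite (Z x)" "finite (Y x)" for x using fin by (auto simp: Y_def Z_def)
  have X2: "x \<notin> X\<^sub>1" if "x \<in> X\<^sub>2" for x using that disj by auto
  interpret box_game "K\<^sub>E n" "X\<^sub>1 \<union> X\<^sub>2" "{X\<^sub>1, X\<^sub>2}" "\<lambda>_ x. star x (Z x)" "\<lambda>x. star x (Y x)"
    "\<lambda>A x. card (A \<inter> star x (Z x))" m t "D + m" q b ?\<F> "{}"
  proof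
    show "finite (K\<^sub>E n)" by (rule finite_edges_complete_graph)
    show "card (A' \<inter> star i (Z i)) \<le> card (A'' \<inter> star i (Z i))" if "A' \<subseteq> A''" for A' A'' i
      using that finZ by (intro card_mono) auto
    show "card (A' \<inter> star i (Z i)) < card (A'' \<inter> star i (Z i))"
      if "A' \<subseteq> A''" "e \<in> star i (Z i)" "e \<notin> A'" "e \<in> A''" for A' A'' i e
      using that finZ by (intro psubset_card_mono) auto
    show "star i (Y i) \<inter> star j (Z j) = {}" if "i \<in> X\<^sub>1 \<union> X\<^sub>2" "j \<in> X\<^sub>1 \<union> X\<^sub>2" "i \<noteq> j" for i j
      using that disj by (auto simp: star_def doubleton_eq_iff Y_def Z_def split: if_splits)
    show "card (star i (Y i) \<inter> A') \<le> card (A' \<inter> star i (Z i))" for A' i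
      using star_mono[OF YZ, of i] finZ by (intro card_mono) auto
    show "star i (Z i) \<subseteq> K\<^sub>E n" if "i \<in> X\<^sub>1 \<union> X\<^sub>2" for i
      using that vert disj by (intro star_subset_K\<^sub>E) (auto simp: Z_def)
    show "q \<le> card (star i (Y i))" if "i \<in> X\<^sub>1 \<union> X\<^sub>2" for i
      using card by (simp add: Y_def)
    show "1 \<le> D + m" using m1 by simp
    show "c \<inter> c' = {}" if "c \<in> {X\<^sub>1, X\<^sub>2}" "c' \<in> {X\<^sub>1, X\<^sub>2}" "c \<noteq> c'" for c c'
      using that disj by auto
    fix A R L i
    assume A: "A \<subseteq> K\<^sub>E n" "R \<subseteq> K\<^sub>E n - A" and L: "L \<subseteq> X\<^sub>1 \<union> X\<^sub>2"
      and BR: "\<And>j. j \<in> L \<Longrightarrow> star j (Z j) - A \<subseteq> R"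
      and res: "\<And>c. c \<in> {X\<^sub>1, X\<^sub>2} \<Longrightarrow> reserve m t (D + m) (L \<inter> c) (\<lambda>x. card (A \<inter> star x (Z x)))"
      and cL: "\<And>c. c \<in> {X\<^sub>1, X\<^sub>2} \<Longrightarrow> (D + m) * (t + 1) \<le> card (L \<inter> c)"
      and i: "i \<in> L" "m \<le> card (A \<inter> star i (Z i))"
    have finA: "finite A" "finite R"
      using A finite_edges_complete_graph by (meson finite_Diff finite_subset)+
    have cL': "D * (t + 1) \<le> card (L \<inter> c)" if "c \<in> {X\<^sub>1, X\<^sub>2}" for c
      using cL[OF that] by (simp add: add_mult_distrib)
    have finL: "finite (L \<inter> X\<^sub>1)" "finite (L \<inter> X\<^sub>2)" using fin by auto
    show "enforcer_wins_enforcer_moves ?\<F> b A R"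
    proof (rule enforcer_wins_or_sparse[OF A(1) finA(2)])
      assume sparse: "card A \<le> (2 * k + 2) * n"
      show "enforcer_wins_enforcer_moves ?\<F> b A R"
      proof (cases "\<exists>u\<in>L \<inter> X\<^sub>1. m \<le> card (A \<inter> star u (Z u))")
        case True
        then obtain u where u: "u \<in> L" "u \<in> X\<^sub>1" "m \<le> card (nbrs A u \<inter> Y\<^sub>1)"
          by (auto simp: card_Int_star Z_def)
        have ZX2: "Z x = X\<^sub>1 \<union> Y\<^sub>2" if "x \<in> X\<^sub>2" for x using X2[OF that] by (simp add: Z_def)
        \<comment> \<open>The class that delivered the first centre is abandoned, and its free edges
          form Enforcer's move into the second stage.\<close>
        have "b < card ((\<Union>i\<in>L \<inter> X\<^sub>1. star i Y\<^sub>1) - A)"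
          using fin finA card disj cL' sparse by (intro many_free_edges) auto
        also have "\<dots> \<le> card (R - (\<Union>i\<in>L \<inter> X\<^sub>2. star i (X\<^sub>1 \<union> Y\<^sub>2)))"
        proof (rule card_mono)
          have "star i Y\<^sub>1 \<inter> star j (X\<^sub>1 \<union> Y\<^sub>2) = {}" if "i \<in> X\<^sub>1" "j \<in> X\<^sub>2" for i j
            using that disj by (auto simp: star_def doubleton_eq_iff)
          moreover have "star i Y\<^sub>1 - A \<subseteq> R" if "i \<in> L \<inter> X\<^sub>1" for i
            using BR[of i] that by (auto simp: Z_def)
          ultimately show "(\<Union>i\<in>L \<inter> X\<^sub>1. star i Y\<^sub>1) - A \<subseteq> R - (\<Union>i\<in>L \<inter> X\<^sub>2. star i (X\<^sub>1 \<union> Y\<^sub>2))"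
            by blast
        qed (use finA in auto)
        finally have bR: "b < card (R - (\<Union>i\<in>L \<inter> X\<^sub>2. star i (X\<^sub>1 \<union> Y\<^sub>2)))" .
        show ?thesis
        proof (rule double_star_second_stage[OF mk vert(2), where Z = "X\<^sub>1 \<union> Y\<^sub>2" and Y = Y\<^sub>2
              and u = u and U = "nbrs A u \<inter> Y\<^sub>1" and L = "L \<inter> X\<^sub>2"])
          show "star j (X\<^sub>1 \<union> Y\<^sub>2) - A \<subseteq> R" if "j \<in> L \<inter> X\<^sub>2" for j
            using BR[of j] ZX2[of j] that by auto
          have "reserve m t (D + m) (L \<inter> X\<^sub>2) (\<lambda>x. card (A \<inter> star x (X\<^sub>1 \<union> Y\<^sub>2)))"
            using res[of X\<^sub>2] by (rule reserve_mono) (auto simp: ZX2)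
          then show "reserve m t D (L \<inter> X\<^sub>2) (\<lambda>x. card (A \<inter> star x (X\<^sub>1 \<union> Y\<^sub>2)))"
            by (rule reserve_weaken) simp
          show "R \<noteq> {}" using bR by auto
        qed (use vert u disj card mk A bR cL' in auto)
      next
        case False
        then have lt: "card (A \<inter> star x (Z x)) < m" if "x \<in> L \<inter> X\<^sub>1" for x
          using that by (meson not_le)
        have v: "i \<in> L \<inter> X\<^sub>2" "i \<notin> X\<^sub>1" using i False L X2 by auto
        have "m \<le> card (nbrs A i \<inter> (X\<^sub>1 \<union> Y\<^sub>2))" using i(2) v(2) by (simp add: card_Int_star Z_def)
        then obtain J where J: "J \<subseteq> nbrs A i \<inter> (X\<^sub>1 \<union> Y\<^sub>2)" "card J = m"
          by (meson obtain_subset_with_card_n)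
        have finJ: "finite J" using J(1) fin by (meson finite_Int finite_Un finite_subset)
        \<comment> \<open>Leaves of the first star in \<open>X\<^sub>1\<close> can no longer be
          centres; the surplus \<open>m\<close> in \<open>D + m\<close> pays for dropping them. The
          edge from a remaining candidate to \<open>i\<close> moves from the box of \<open>i\<close>
          into that of the candidate.\<close>
        define L' where "L' = L \<inter> X\<^sub>1 - J"
        let ?Z = "insert i Y\<^sub>1"
        have "reserve m t D L' (\<lambda>x. card (A \<inter> star x (Z x)))"
          unfolding L'_def using res[of X\<^sub>1] lt finL finJ J(2) by (intro reserve_remove) auto
        moreover from this have cL'': "D * (t + 1) \<le> card L'"
          by (rule reserve_card) (use lt m1 in \<open>auto simp: L'_def\<close>)
        ultimately have res': "reserve m t D L' (\<lambda>x. card (A \<inter> star x ?Z))"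
          using fin by (elim reserve_mono) (auto simp: L'_def Z_def star_def intro!: card_mono)
        have "b < card ((\<Union>i\<in>L \<inter> X\<^sub>2. star i Y\<^sub>2) - A)"
          using fin finA card disj cL' sparse by (intro many_free_edges) auto
        also have "\<dots> \<le> card (R - (\<Union>x\<in>L'. star x ?Z))"
        proof (rule card_mono)
          have "star j Y\<^sub>2 \<inter> star x ?Z = {}" if "x \<in> X\<^sub>1" "j \<in> X\<^sub>2" for x j
            using that disj v by (auto simp: star_def doubleton_eq_iff)
          moreover have "star j Y\<^sub>2 - A \<subseteq> R" if "j \<in> L \<inter> X\<^sub>2" for j
            using BR[of j] X2[of j] that by (auto simp: Z_def star_def)
          ultimately show "(\<Union>i\<in>L \<inter> X\<^sub>2. star i Y\<^sub>2) - A \<subseteq> R - (\<Union>x\<in>L'. star x ?Z)"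
            unfolding L'_def by blast
        qed (use finA in auto)
        finally have bR: "b < card (R - (\<Union>x\<in>L'. star x ?Z))" .
        show ?thesis
        proof (rule double_star_second_stage[OF mk, where I = "X\<^sub>1 - J" and Z = ?Z and Y = Y\<^sub>1
              and u = i and U = J and L = L'])
          show "star j ?Z - A \<subseteq> R" if "j \<in> L'" for j
          proof -
            have "star j Y\<^sub>1 - A \<subseteq> R" using BR[of j] that by (auto simp: L'_def Z_def)
            moreover have "{j, i} \<in> star i (Z i)" using that v by (auto simp: L'_def Z_def star_def)
            then have "{{j, i}} - A \<subseteq> R" using BR[OF i(1)] by blast
            ultimately show ?thesis by (auto simp: star_def)
          qed
          show "insert i Y\<^sub>1 \<inter> J = {}" using J v disj nbrs_K\<^sub>E[OF A(1)] by fastforce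
          show "R \<noteq> {}" using bR by auto
        qed (use vert v J disj card mk A bR res' cL'' in \<open>auto simp: L'_def\<close>)
      qed
    qed simp
  qed (use fin mq m1 b star_mono[OF YZ] in auto)
  have D1: "(D + m) * (t + 1) \<le> q" "D * (t + 1) \<le> q"
  proof -
    have "reserve m t (D + m) X\<^sub>1 (\<lambda>_. 0)" using q card by (intro reserve_initial) simp
    then show "(D + m) * (t + 1) \<le> q" using m1 card by (auto dest!: reserve_card)
    then show "D * (t + 1) \<le> q" by (simp add: add_mult_distrib)
  qed
  show ?thesis unfolding enforcer_wins_def
  proof (rule avoider_step)
    have "0 < card X\<^sub>1" "0 < card X\<^sub>2" using card mq m1 by auto
    then obtain x y where xy: "x \<in> X\<^sub>1" "y \<in> X\<^sub>2" by (metis card_gt_0_iff ex_in_conv)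
    then have "{x, y} \<in> K\<^sub>E n" using K\<^sub>E_iff[of x y n] vert disj by auto
    then show "K\<^sub>E n \<noteq> {}" by blast
    fix S assume "legal_move 1 (K\<^sub>E n) S"
    then have S: "S \<subseteq> K\<^sub>E n" by (simp add: legal_move_def)
    have finS: "finite S" using S finite_edges_complete_graph finite_subset by blast
    show "enforcer_wins_enforcer_moves ?\<F> b ({} \<union> S) (K\<^sub>E n - S)"
    proof (rule enforcer_wins_or_sparse)
      assume "card ({} \<union> S) \<le> (2 * k + 2) * n"
      then have "b < card ((\<Union>i\<in>X\<^sub>1. star i Y\<^sub>2) - S)"
        using fin finS card disj D1 by (intro many_free_edges) auto
      also have "\<dots> \<le> card (K\<^sub>E n - S - (\<Union>i\<in>X\<^sub>1 \<union> X\<^sub>2. star i (Z i)))"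
      proof (rule card_mono)
        have "star i Y\<^sub>2 \<subseteq> K\<^sub>E n" if "i \<in> X\<^sub>1" for i
          using that vert disj by (intro star_subset_K\<^sub>E) auto
        moreover have "star i Y\<^sub>2 \<inter> star j (Z j) = {}" if "i \<in> X\<^sub>1" "j \<in> X\<^sub>1 \<union> X\<^sub>2" for i j
          using that disj by (auto simp: star_def doubleton_eq_iff Z_def)
        ultimately show "(\<Union>i\<in>X\<^sub>1. star i Y\<^sub>2) - S \<subseteq> K\<^sub>E n - S - (\<Union>i\<in>X\<^sub>1 \<union> X\<^sub>2. star i (Z i))"
          by blast
      qed (simp add: finite_edges_complete_graph)
      finally have bR: "b < card (K\<^sub>E n - S - (\<Union>i\<in>X\<^sub>1 \<union> X\<^sub>2. star i (Z i)))" .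
      have Int: "(X\<^sub>1 \<union> X\<^sub>2) \<inter> c = c" if "c \<in> {X\<^sub>1, X\<^sub>2}" for c using that by auto
      show "enforcer_wins_enforcer_moves ?\<F> b ({} \<union> S) (K\<^sub>E n - S)"
      proof (rule enforcer_to_move[where L = "X\<^sub>1 \<union> X\<^sub>2"])
        show "reserve m t (D + m) ((X\<^sub>1 \<union> X\<^sub>2) \<inter> c) (\<lambda>x. card (({} \<union> S) \<inter> star x (Z x)))"
          if "c \<in> {X\<^sub>1, X\<^sub>2}" for c
          using q card that by (intro reserve_initial) (auto simp: Int)
        show "(D + m) * (t + 1) \<le> card ((X\<^sub>1 \<union> X\<^sub>2) \<inter> c)" if "c \<in> {X\<^sub>1, X\<^sub>2}" for c
          unfolding Int[OF that] using that D1 card by auto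
        show "star j (Z j) - ({} \<union> S) \<subseteq> K\<^sub>E n - S" if "j \<in> X\<^sub>1 \<union> X\<^sub>2" for j
          using that B_E by auto
        show "K\<^sub>E n - S \<noteq> {}" using bR by (metis card.empty empty_Diff not_less_zero)
      qed (use S bR in auto)
    qed (use S in \<open>auto simp: finite_edges_complete_graph\<close>)
  qed
qed

subsection \<open>Path double stars\<close>

text \<open>Second stage if Avoider already has a star with centre \<open>u\<close> and leaves in \<open>Y\<^sub>1\<close>. The path
  from \<open>x\<close> to \<open>u\<close> is planned through the vertex \<open>y x\<close>.\<close>

lemma (in enforcer_setting) path_double_star_second_stage_left:
  fixes y :: "nat \<Rightarrow> nat" and L Y\<^sub>1 Y\<^sub>2 :: "nat set" and u :: nat
  defines "Bx \<equiv> \<lambda>x. star x Y\<^sub>2 \<union> {{x, y x}, {u, y x}}"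
  assumes mk: "m = k"
    and vert: "L \<subseteq> {..<n}" "Y\<^sub>1 \<subseteq> {..<n}" "Y\<^sub>2 \<subseteq> {..<n}" "u < n"
    and disj: "L \<inter> Y\<^sub>1 = {}" "L \<inter> Y\<^sub>2 = {}" "Y\<^sub>1 \<inter> Y\<^sub>2 = {}" "u \<notin> L" "u \<notin> Y\<^sub>1" "u \<notin> Y\<^sub>2"
    and Y: "q \<le> card Y\<^sub>2"
    and y: "\<And>x. x \<in> L \<Longrightarrow> y x \<in> Y\<^sub>1 \<and> ({x, y x} \<in> A \<or> {u, y x} \<in> A)"
    and U: "k \<le> card (nbrs A u \<inter> Y\<^sub>1)"
    and pos: "A \<subseteq> K\<^sub>E n" "R \<subseteq> K\<^sub>E n - A" "\<And>j. j \<in> L \<Longrightarrow> Bx j - A \<subseteq> R"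
    and res: "reserve m t D L (\<lambda>x. card (A \<inter> Bx x))" "D * (t + 1) \<le> card L"
    and bR: "R \<noteq> {}" "b \<le> card (R - (\<Union>i\<in>L. Bx i))"
  shows "enforcer_wins_enforcer_moves (copies (path_double_star k) (complete_graph n)) b A R"
proof -
  let ?\<F> = "copies (path_double_star k) (complete_graph n)"
  have fin: "finite L" "finite Y\<^sub>1" "finite Y\<^sub>2" using vert by (meson finite_lessThan finite_subset)+
  have finB: "finite (Bx x)" for x using fin by (simp add: Bx_def)
  have B_K: "Bx x \<subseteq> K\<^sub>E n" if "x \<in> L" for x
  proof -
    have "star x Y\<^sub>2 \<subseteq> K\<^sub>E n" using that vert disj by (intro star_subset_K\<^sub>E) auto
    moreover have "{x, y x} \<in> K\<^sub>E n" "{u, y x} \<in> K\<^sub>E n"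
      unfolding K\<^sub>E_iff using y[OF that] that vert disj by auto
    ultimately show ?thesis by (simp add: Bx_def)
  qed
  \<comment> \<open>Several boxes may share the edge \<open>{u, y x}\<close>; only the stars to
    \<open>Y\<^sub>2\<close> are private.\<close>
  interpret box_game "K\<^sub>E n" L "{L}" "\<lambda>_. Bx" "\<lambda>x. star x Y\<^sub>2" "\<lambda>A x. card (A \<inter> Bx x)"
    m t D q b ?\<F> A
  proof
    show "finite (K\<^sub>E n)" by (rule finite_edges_complete_graph)
    show "card (A' \<inter> Bx i) \<le> card (A'' \<inter> Bx i)" if "A' \<subseteq> A''" for A' A'' i
      using that finB by (intro card_mono) auto
    show "card (A' \<inter> Bx i) < card (A'' \<inter> Bx i)"
      if "A' \<subseteq> A''" "e \<in> Bx i" "e \<notin> A'" "e \<in> A''" for A' A'' i e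
      using that finB by (intro psubset_card_mono) auto
    show "star i Y\<^sub>2 \<inter> Bx j = {}" if "i \<in> L" "j \<in> L" "i \<noteq> j" for i j
    proof -
      have "y j \<in> Y\<^sub>1" using y that by blast
      then have "{j, y j} \<notin> star i Y\<^sub>2" "{u, y j} \<notin> star i Y\<^sub>2"
        using that disj by (auto simp: star_def doubleton_eq_iff)
      moreover have "star i Y\<^sub>2 \<inter> star j Y\<^sub>2 = {}"
        using that disj by (intro star_Int_star_disjoint) auto
      ultimately show ?thesis by (auto simp: Bx_def)
    qed
    show "card (star i Y\<^sub>2 \<inter> A') \<le> card (A' \<inter> Bx i)" for A' i
      using finB by (intro card_mono) (auto simp: Bx_def)
    show "star i Y\<^sub>2 \<subseteq> Bx i" for i unfolding Bx_def by (rule Un_upper1)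
    show "1 \<le> D" by (simp add: D)
    fix A' R' L' i
    assume *: "A \<subseteq> A'" "A' \<subseteq> K\<^sub>E n" "R' \<subseteq> K\<^sub>E n - A'" "L' \<subseteq> L"
      and BR: "\<And>j. j \<in> L' \<Longrightarrow> Bx j - A' \<subseteq> R'"
      and "\<And>c. c \<in> {L} \<Longrightarrow> reserve m t D (L' \<inter> c) (\<lambda>x. card (A' \<inter> Bx x))"
      and cL: "\<And>c. c \<in> {L} \<Longrightarrow> D * (t + 1) \<le> card (L' \<inter> c)"
      and i: "i \<in> L'" "m \<le> card (A' \<inter> Bx i)"
    have iL: "i \<in> L" using i * by auto
    have yi: "y i \<in> Y\<^sub>1" using y[OF iL] by simp
    define W where "W = nbrs A' i \<inter> Y\<^sub>2"
    have cB: "card (A' \<inter> Bx i) \<le> card W + card (A' \<inter> {{i, y i}, {u, y i}})"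
      unfolding Bx_def W_def card_Int_star[symmetric] Int_Un_distrib by (rule card_Un_le)
    have F: "\<exists>F\<in>?\<F>. F \<subseteq> insert e A'"
      if "e \<in> Bx i" "{i, y i} \<in> insert e A'" "{u, y i} \<in> insert e A'"
        "V \<subseteq> nbrs (insert e A') i \<inter> Y\<^sub>2" "k - 1 \<le> card V" for e V
    proof (rule path_double_star_in[where u = u and w = "y i" and v = i
          and U = "nbrs A u \<inter> Y\<^sub>1 - {y i}" and V = V])
      show "insert e A' \<subseteq> K\<^sub>E n" using *(2) B_K[OF iL] that(1) by blast
      show "{u, y i} \<in> insert e A'" "{i, y i} \<in> insert e A'" "k - 1 \<le> card V" by fact+
      show "nbrs A u \<inter> Y\<^sub>1 - {y i} \<subseteq> nbrs (insert e A') u" using *(1) by (auto simp: nbrs_def)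
      show "V \<subseteq> nbrs (insert e A') i" using that by blast
      have "card (nbrs A u \<inter> Y\<^sub>1) - 1 \<le> card (nbrs A u \<inter> Y\<^sub>1 - {y i})"
        using diff_card_le_card_Diff[of "{y i}"] by simp
      then show "k - 1 \<le> card (nbrs A u \<inter> Y\<^sub>1 - {y i})" using U by linarith
      have "V \<subseteq> Y\<^sub>2" using that by blast
      then show "(nbrs A u \<inter> Y\<^sub>1 - {y i}) \<inter> V = {}" "u \<notin> V" "y i \<notin> V" using disj yi by auto
      show "u \<noteq> i" "i \<notin> nbrs A u \<inter> Y\<^sub>1 - {y i}" using disj iL by auto
    qed simp
    have "\<exists>e\<in>Bx i. \<exists>F\<in>?\<F>. F \<subseteq> insert e A'"
    \<comment> \<open>If both path edges are claimed, level \<open>k\<close> leaves at least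
      \<open>k - 2\<close> leaves and one more is missing. Otherwise there are \<open>k - 1\<close>
      leaves, and by the choice of \<open>y\<close> only one path edge is missing.\<close>
    proof (cases "{i, y i} \<in> A' \<and> {u, y i} \<in> A'")
      case True
      have "card (A' \<inter> {{i, y i}, {u, y i}}) \<le> card {{i, y i}, {u, y i}}" by (intro card_mono) auto
      also have "\<dots> \<le> 2" by (simp add: card_insert_if)
      finally have "k - 2 \<le> card W" using cB i(2) mk by linarith
      then obtain T where T: "T \<subseteq> W" "card T = k - 2" by (meson obtain_subset_with_card_n)
      have finT: "finite T" using T fin by (auto simp: W_def intro: finite_subset)
      have "card T < card Y\<^sub>2" using T Y mq mk k by linarith
      then obtain z where z: "z \<in> Y\<^sub>2" "z \<notin> T" by (meson card_mono finT leD subsetI)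
      have "{i, z} \<in> Bx i" using z by (auto simp: Bx_def star_def)
      moreover have "\<exists>F\<in>?\<F>. F \<subseteq> insert {i, z} A'"
      proof (rule F[where V = "insert z T"])
        show "insert z T \<subseteq> nbrs (insert {i, z} A') i \<inter> Y\<^sub>2"
          using T z by (auto simp: W_def nbrs_def)
        show "k - 1 \<le> card (insert z T)" using T z finT by simp
      qed (use calculation True in auto)
      ultimately show ?thesis by blast
    next
      case False
      obtain e where e: "e \<in> {{i, y i}, {u, y i}}" "{i, y i} \<in> insert e A'" "{u, y i} \<in> insert e A'"
        using y[OF iL] *(1) by auto
      have "A' \<inter> {{i, y i}, {u, y i}} \<subseteq> {{i, y i}} \<or> A' \<inter> {{i, y i}, {u, y i}} \<subseteq> {{u, y i}}"
        using False by auto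
      then have "card (A' \<inter> {{i, y i}, {u, y i}}) \<le> 1"
        by (elim disjE) (drule card_mono[rotated], simp, simp)+
      then have "k - 1 \<le> card W" using cB i(2) mk by linarith
      then have "\<exists>F\<in>?\<F>. F \<subseteq> insert e A'"
        using e by (intro F[where V = W]) (auto simp: Bx_def W_def nbrs_def)
      then show ?thesis using e(1) by (auto simp: Bx_def)
    qed
    then obtain e where e: "e \<in> Bx i" "\<exists>F\<in>?\<F>. F \<subseteq> insert e A'" by blast
    have "e \<in> A' \<union> R'" using e BR[OF i(1)] by blast
    moreover have "finite L'" "L' \<inter> Y\<^sub>2 = {}" using * fin disj by (auto intro: finite_subset)
    moreover have "L' \<inter> L = L'" using * by auto
    then have "D * (t + 1) \<le> card L'" using cL[of L] by simp
    moreover have "(\<Union>i\<in>L'. star i Y\<^sub>2) - A' \<subseteq> R'" using BR by (auto simp: Bx_def)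
    ultimately show "enforcer_wins_enforcer_moves ?\<F> b A' R'"
      using *(2,3) fin Y e(2) by (intro enforcer_wins_if_completes[of A' R' _ e L' Y\<^sub>2]) auto
  qed (use fin mq m1 b Y B_K in auto)
  show ?thesis using pos res bR by (intro enforcer_to_move[where L = L]) auto
qed

text \<open>Second stage if Avoider already has a star with centre \<open>v\<close> and leaf set \<open>V\<close>. As soon as \<open>v\<close> has
  a neighbour in \<open>Y\<^sub>1\<close>, the other edges from \<open>v\<close> to \<open>Y\<^sub>1\<close> are no longer part of any box.\<close>

lemma (in enforcer_setting) path_double_star_second_stage_right:
  fixes L Y V :: "nat set" and v :: nat
  defines "Bx \<equiv> \<lambda>A x. star x Y \<union> (if star v Y \<inter> A = {} then star v Y else {})"
    and "lv \<equiv> \<lambda>A x. card (A \<inter> star x Y) + (if star v Y \<inter> A = {} then 0 else 1)"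
  assumes mk: "m = k"
    and vert: "L \<subseteq> {..<n}" "Y \<subseteq> {..<n}" "v < n"
    and disj: "L \<inter> Y = {}" "L \<inter> V = {}" "Y \<inter> V = {}" "v \<notin> L" "v \<notin> Y"
    and Y: "q \<le> card Y"
    and V: "V \<subseteq> nbrs A v" "k - 1 \<le> card V"
    and pos: "A \<subseteq> K\<^sub>E n" "R \<subseteq> K\<^sub>E n - A" "\<And>j. j \<in> L \<Longrightarrow> Bx A j - A \<subseteq> R"
    and res: "reserve m t D L (lv A)" "D * (t + 1) \<le> card L"
    and bR: "R \<noteq> {}" "b \<le> card (R - (\<Union>i\<in>L. Bx A i))"
  shows "enforcer_wins_enforcer_moves (copies (path_double_star k) (complete_graph n)) b A R"
proof -
  let ?\<F> = "copies (path_double_star k) (complete_graph n)"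
  have fin: "finite L" "finite Y" using vert by (meson finite_lessThan finite_subset)+
  have B_K: "Bx A' x \<subseteq> K\<^sub>E n" if "x \<in> L" for A' x
  proof -
    have "star x Y \<subseteq> K\<^sub>E n" using that vert disj by (intro star_subset_K\<^sub>E) auto
    moreover have "star v Y \<subseteq> K\<^sub>E n" using vert disj by (intro star_subset_K\<^sub>E) auto
    ultimately show ?thesis by (simp add: Bx_def)
  qed
  \<comment> \<open>An edge from \<open>v\<close> to \<open>Y\<close> raises all boxes at once, but
    only the first one counts, since a single midpoint is enough.\<close>
  interpret box_game "K\<^sub>E n" L "{L}" Bx "\<lambda>x. star x Y" lv m t D q b ?\<F> A
  proof
    show "finite (K\<^sub>E n)" by (rule finite_edges_complete_graph)
    show "lv A' i \<le> lv A'' i" if "A' \<subseteq> A''" for A' A'' i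
    proof -
      have "card (A' \<inter> star i Y) \<le> card (A'' \<inter> star i Y)"
        using that fin by (intro card_mono) auto
      then show ?thesis using that by (auto simp: lv_def)
    qed
    show "lv A' i < lv A'' i" if "A' \<subseteq> A''" "e \<in> Bx A' i" "e \<notin> A'" "e \<in> A''" for A' A'' i e
    proof -
      have 1: "card (A' \<inter> star i Y) \<le> card (A'' \<inter> star i Y)"
        using that fin by (intro card_mono) auto
      show ?thesis
      proof (cases "e \<in> star i Y")
        case True
        then have "card (A' \<inter> star i Y) < card (A'' \<inter> star i Y)"
          using that fin by (intro psubset_card_mono) auto
        then show ?thesis using that by (auto simp: lv_def)
      next
        case False
        then have "star v Y \<inter> A' = {}" "e \<in> star v Y" using that(2) by (auto simp: Bx_def split: if_splits)
        then show ?thesis using 1 that(4) by (auto simp: lv_def)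
      qed
    qed
    show "Bx A'' i \<subseteq> Bx A' i" if "A' \<subseteq> A''" for A' A'' i using that by (auto simp: Bx_def)
    show "star i Y \<inter> Bx A' j = {}" if "i \<in> L" "j \<in> L" "i \<noteq> j" for A' i j
      using that disj by (auto simp: star_def doubleton_eq_iff Bx_def)
    show "card (star i Y \<inter> A') \<le> lv A' i" for A' i
      by (simp add: lv_def Int_commute)
    show "star i Y \<subseteq> Bx A' i" for A' i by (simp add: Bx_def)
    show "1 \<le> D" by (simp add: D)
    fix A' R' L' i
    assume *: "A \<subseteq> A'" "A' \<subseteq> K\<^sub>E n" "R' \<subseteq> K\<^sub>E n - A'" "L' \<subseteq> L"
      and BR: "\<And>j. j \<in> L' \<Longrightarrow> Bx A' j - A' \<subseteq> R'"
      and "\<And>c. c \<in> {L} \<Longrightarrow> reserve m t D (L' \<inter> c) (lv A')"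
      and cL: "\<And>c. c \<in> {L} \<Longrightarrow> D * (t + 1) \<le> card (L' \<inter> c)"
      and i: "i \<in> L'" "m \<le> lv A' i"
    have iL: "i \<in> L" using i * by auto
    define W where "W = nbrs A' i \<inter> Y"
    have cB: "k \<le> card W + (if star v Y \<inter> A' = {} then 0 else 1)"
      using i(2) by (simp add: lv_def W_def card_Int_star mk)
    have F: "\<exists>F\<in>?\<F>. F \<subseteq> insert e A'"
      if "e \<in> Bx A' i" "w \<in> Y" "{i, w} \<in> insert e A'" "{v, w} \<in> insert e A'"
        "U \<subseteq> nbrs (insert e A') i \<inter> Y - {w}" "k - 1 \<le> card U" for e w U
    proof (rule path_double_star_in)
      show "insert e A' \<subseteq> K\<^sub>E n" using *(2) B_K[OF iL, of A'] that(1) by blast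
      show "{i, w} \<in> insert e A'" "{v, w} \<in> insert e A'" "k - 1 \<le> card U" "k - 1 \<le> card V" by fact+
      show "V \<subseteq> nbrs (insert e A') v" using V *(1) by (auto simp: nbrs_def)
      show "U \<subseteq> nbrs (insert e A') i" "w \<notin> U" using that by auto
      have "U \<subseteq> Y" using that by blast
      then show "U \<inter> V = {}" "v \<notin> U" "i \<notin> V" "w \<notin> V" "i \<noteq> v" using disj iL that(2) by auto
    qed
    have "\<exists>e\<in>Bx A' i. \<exists>F\<in>?\<F>. F \<subseteq> insert e A'"
    proof (cases "star v Y \<inter> A' = {}")
      case True
      then have cW: "k \<le> card W" using cB by simp
      \<comment> \<open>Any neighbour of \<open>i\<close> can be the midpoint, at the cost of one of
        the \<open>k\<close> leaves; the edge from \<open>v\<close> to it is the missing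
        one.\<close>
      then obtain w where w: "w \<in> W" using k by (metis card.empty ex_in_conv not_numeral_le_zero le_trans)
      have "{v, w} \<in> Bx A' i" using w True by (auto simp: Bx_def star_def W_def)
      moreover have "\<exists>F\<in>?\<F>. F \<subseteq> insert {v, w} A'"
      proof (rule F[where w = w and U = "W - {w}"])
        show "k - 1 \<le> card (W - {w})" using cW w by simp
      qed (use calculation w in \<open>auto simp: W_def nbrs_def\<close>)
      ultimately show ?thesis by blast
    next
      case False
      then obtain w where w: "w \<in> Y" "{v, w} \<in> A'" by (auto simp: star_def)
      have "k - 1 \<le> card W" using cB False by simp
      moreover have "k - 1 < card Y" "1 \<le> k - 1" using Y mq mk k by linarith+
      moreover have "W \<subseteq> Y" by (simp add: W_def)
      ultimately obtain z U where z: "z \<in> Y" "w \<in> insert z W" and U: "U \<subseteq> insert z W - {w}" "k - 1 \<le> card U"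
        using star_completion[of W Y "k - 1" w] w(1) fin by blast
      have "{i, z} \<in> Bx A' i" using z by (auto simp: Bx_def star_def)
      moreover have "\<exists>F\<in>?\<F>. F \<subseteq> insert {i, z} A'"
        using calculation w z U
        by (intro F[where w = w and U = U]) (auto simp: W_def nbrs_def)
      ultimately show ?thesis by blast
    qed
    then obtain e where e: "e \<in> Bx A' i" "\<exists>F\<in>?\<F>. F \<subseteq> insert e A'" by blast
    have "e \<in> A' \<union> R'" using e BR[OF i(1)] by blast
    moreover have "finite L'" "L' \<inter> Y = {}" using * fin disj by (auto intro: finite_subset)
    moreover have "L' \<inter> L = L'" using * by auto
    then have "D * (t + 1) \<le> card L'" using cL[of L] by simp
    moreover have "(\<Union>i\<in>L'. star i Y) - A' \<subseteq> R'" using BR by (auto simp: Bx_def)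
    ultimately show "enforcer_wins_enforcer_moves ?\<F> b A' R'"
      using *(2,3) fin Y e(2) by (intro enforcer_wins_if_completes[of A' R' _ e L' Y]) auto
  qed (use fin mq m1 b Y B_K in auto)
  show ?thesis using pos res bR by (intro enforcer_to_move[where L = L]) auto
qed

text \<open>The midpoint is sought in \<open>Y\<^sub>1\<close> in either case. A candidate in
  \<open>X\<^sub>2\<close> needs only one neighbour there, so its edges to \<open>Y\<^sub>1\<close>
  together count as one level and leave its box as soon as one is claimed.\<close>

lemma (in enforcer_setting) path_double_star_first_stage:
  assumes mk: "m = k"
    and vert: "X\<^sub>1 \<subseteq> {..<n}" "X\<^sub>2 \<subseteq> {..<n}" "Y\<^sub>1 \<subseteq> {..<n}" "Y\<^sub>2 \<subseteq> {..<n}"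
    and card: "card X\<^sub>1 = q" "card X\<^sub>2 = q" "card Y\<^sub>1 = q" "card Y\<^sub>2 = q"
    and disj: "X\<^sub>1 \<inter> X\<^sub>2 = {}" "X\<^sub>1 \<inter> Y\<^sub>1 = {}" "X\<^sub>1 \<inter> Y\<^sub>2 = {}" "X\<^sub>2 \<inter> Y\<^sub>1 = {}" "X\<^sub>2 \<inter> Y\<^sub>2 = {}" "Y\<^sub>1 \<inter> Y\<^sub>2 = {}"
    and q: "(m + (D + m)) * (t + 1) ^ m \<le> q"
  shows "enforcer_wins (path_double_star k) n b"
proof -
  let ?\<F> = "copies (path_double_star k) (complete_graph n)"
  have fin: "finite X\<^sub>1" "finite X\<^sub>2" "finite Y\<^sub>1" "finite Y\<^sub>2"
    using vert by (meson finite_lessThan finite_subset)+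
  define Y where "Y x = (if x \<in> X\<^sub>1 then Y\<^sub>1 else Y\<^sub>2)" for x
  define Bx where
    "Bx A x = star x (Y x) \<union> (if x \<in> X\<^sub>2 \<and> star x Y\<^sub>1 \<inter> A = {} then star x Y\<^sub>1 else {})" for A x
  define lv where
    "lv A x = card (A \<inter> star x (Y x)) + (if x \<in> X\<^sub>2 \<and> star x Y\<^sub>1 \<inter> A \<noteq> {} then 1 else 0)" for A x
  have finY: "finite (Y x)" for x using fin by (auto simp: Y_def)
  have X2: "x \<notin> X\<^sub>1" if "x \<in> X\<^sub>2" for x using that disj by auto
  have YB: "star x (Y x) \<subseteq> Bx A x" for A x unfolding Bx_def by (rule Un_upper1)
  have B_K: "Bx A x \<subseteq> K\<^sub>E n" if "x \<in> X\<^sub>1 \<union> X\<^sub>2" for A x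
  proof -
    have "star x (Y x) \<subseteq> K\<^sub>E n" "star x Y\<^sub>1 \<subseteq> K\<^sub>E n"
      using that vert disj by (intro star_subset_K\<^sub>E; auto simp: Y_def)+
    then show ?thesis by (simp add: Bx_def)
  qed
  interpret box_game "K\<^sub>E n" "X\<^sub>1 \<union> X\<^sub>2" "{X\<^sub>1, X\<^sub>2}" Bx "\<lambda>x. star x (Y x)" lv m t "D + m" q b ?\<F> "{}"
  proof
    show "finite (K\<^sub>E n)" by (rule finite_edges_complete_graph)
    have le: "card (A' \<inter> star i (Y i)) \<le> card (A'' \<inter> star i (Y i))" if "A' \<subseteq> A''" for A' A'' i
      using that finY by (intro card_mono) auto
    show "lv A' i \<le> lv A'' i" if "A' \<subseteq> A''" for A' A'' i
      using le[OF that, of i] that by (auto simp: lv_def)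
    show "lv A' i < lv A'' i" if "A' \<subseteq> A''" "e \<in> Bx A' i" "e \<notin> A'" "e \<in> A''" for A' A'' i e
    proof (cases "e \<in> star i (Y i)")
      case True
      then have "card (A' \<inter> star i (Y i)) < card (A'' \<inter> star i (Y i))"
        using that finY by (intro psubset_card_mono) auto
      then show ?thesis using that by (auto simp: lv_def)
    next
      case False
      then have "i \<in> X\<^sub>2" "star i Y\<^sub>1 \<inter> A' = {}" "e \<in> star i Y\<^sub>1"
        using that(2) by (auto simp: Bx_def split: if_splits)
      then show ?thesis using le[OF that(1), of i] that(4) by (auto simp: lv_def)
    qed
    show "Bx A'' i \<subseteq> Bx A' i" if "A' \<subseteq> A''" for A' A'' i using that by (auto simp: Bx_def)
    show "star i (Y i) \<inter> Bx A' j = {}" if "i \<in> X\<^sub>1 \<union> X\<^sub>2" "j \<in> X\<^sub>1 \<union> X\<^sub>2" "i \<noteq> j" for A' i j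
    proof -
      have "star i (Y i) \<inter> star j (Y j) = {}" "star i (Y i) \<inter> star j Y\<^sub>1 = {}"
        using that disj by (intro star_Int_star_disjoint; auto simp: Y_def)+
      then show ?thesis by (auto simp: Bx_def)
    qed
    show "card (star i (Y i) \<inter> A') \<le> lv A' i" for A' i by (simp add: lv_def Int_commute)
    show "q \<le> card (star i (Y i))" if "i \<in> X\<^sub>1 \<union> X\<^sub>2" for i
      using card by (simp add: Y_def)
    show "1 \<le> D + m" using m1 by simp
    show "c \<inter> c' = {}" if "c \<in> {X\<^sub>1, X\<^sub>2}" "c' \<in> {X\<^sub>1, X\<^sub>2}" "c \<noteq> c'" for c c'
      using that disj by auto
    fix A R L i
    assume A: "A \<subseteq> K\<^sub>E n" "R \<subseteq> K\<^sub>E n - A" and L: "L \<subseteq> X\<^sub>1 \<union> X\<^sub>2"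
      and BR: "\<And>j. j \<in> L \<Longrightarrow> Bx A j - A \<subseteq> R"
      and res: "\<And>c. c \<in> {X\<^sub>1, X\<^sub>2} \<Longrightarrow> reserve m t (D + m) (L \<inter> c) (lv A)"
      and cL: "\<And>c. c \<in> {X\<^sub>1, X\<^sub>2} \<Longrightarrow> (D + m) * (t + 1) \<le> card (L \<inter> c)"
      and i: "i \<in> L" "m \<le> lv A i"
    have finA: "finite A" "finite R"
      using A finite_edges_complete_graph by (meson finite_Diff finite_subset)+
    have cL': "D * (t + 1) \<le> card (L \<inter> c)" if "c \<in> {X\<^sub>1, X\<^sub>2}" for c
      using cL[OF that] by (simp add: add_mult_distrib)
    have YR: "star j (Y j) - A \<subseteq> R" if "j \<in> L" for j using BR[OF that] YB[of j A] by blast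
    show "enforcer_wins_enforcer_moves ?\<F> b A R"
    proof (rule enforcer_wins_or_sparse[OF A(1) finA(2)])
      assume sparse: "card A \<le> (2 * k + 2) * n"
      show "enforcer_wins_enforcer_moves ?\<F> b A R"
      proof (cases "i \<in> X\<^sub>1")
        case True
        then have "i \<notin> X\<^sub>2" using X2 by blast
        with i(2) True have U: "k \<le> card (nbrs A i \<inter> Y\<^sub>1)"
          by (simp add: lv_def Y_def card_Int_star mk)
        then obtain y0 where y0: "y0 \<in> nbrs A i \<inter> Y\<^sub>1"
          using k by (metis card.empty ex_in_conv not_numeral_le_zero le_trans)
        \<comment> \<open>The midpoint for \<open>x\<close> is a neighbour of \<open>x\<close> if
          possible and otherwise one of \<open>i\<close>, so that Avoider already owns one of the
          two path edges.\<close>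
        define y where "y x = (if nbrs A x \<inter> Y\<^sub>1 = {} then y0 else (SOME z. z \<in> nbrs A x \<inter> Y\<^sub>1))" for x
        have y: "y x \<in> Y\<^sub>1" "nbrs A x \<inter> Y\<^sub>1 = {} \<Longrightarrow> {i, y x} \<in> A"
          "nbrs A x \<inter> Y\<^sub>1 \<noteq> {} \<Longrightarrow> {x, y x} \<in> A" for x
          using y0 some_in_eq[of "nbrs A x \<inter> Y\<^sub>1"] by (auto simp: y_def nbrs_def)
        have no_nbr: "nbrs A x \<inter> Y\<^sub>1 = {} \<longleftrightarrow> star x Y\<^sub>1 \<inter> A = {}" for x
          by (auto simp: nbrs_def star_def)
        define B' where "B' x = star x Y\<^sub>2 \<union> {{x, y x}, {i, y x}}" for x
        have finB': "finite (B' x)" for x using fin by (simp add: B'_def)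
        \<comment> \<open>The new boxes use edges from \<open>i\<close> to \<open>Y\<^sub>1\<close>,
          so the star of \<open>i\<close> must be spared; the surplus \<open>m\<close> in
          \<open>D + m\<close> pays for it.\<close>
        have "D * (t + 1) \<le> card (L \<inter> X\<^sub>1 - {i})"
        proof -
          have "1 \<le> m * (t + 1)" using m1 by simp
          then have "D * (t + 1) \<le> card (L \<inter> X\<^sub>1) - 1"
            using cL[OF insertI1] unfolding add_mult_distrib[of D m] by linarith
          then show ?thesis using True i by simp
        qed
        then have "b < card ((\<Union>x\<in>L \<inter> X\<^sub>1 - {i}. star x Y\<^sub>1) - A)"
          using fin finA card disj sparse by (intro many_free_edges) auto
        also have "\<dots> \<le> card (R - (\<Union>x\<in>L \<inter> X\<^sub>2. B' x))"
        proof (rule card_mono)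
          have "star x Y\<^sub>1 \<inter> B' j = {}" if x: "x \<in> X\<^sub>1 - {i}" and j: "j \<in> X\<^sub>2" for x j
          proof -
            have "star x Y\<^sub>1 \<inter> star j Y\<^sub>2 = {}" "star x Y\<^sub>1 \<inter> star j Y\<^sub>1 = {}" "star x Y\<^sub>1 \<inter> star i Y\<^sub>1 = {}"
              using x j disj True by (intro star_Int_star_disjoint; auto)+
            moreover have "{j, y j} \<in> star j Y\<^sub>1" "{i, y j} \<in> star i Y\<^sub>1"
              using y(1) by (auto simp: star_def)
            ultimately show ?thesis unfolding B'_def by blast
          qed
          moreover have "star x Y\<^sub>1 - A \<subseteq> R" if "x \<in> L \<inter> X\<^sub>1" for x
            using YR[of x] that by (simp add: Y_def)
          ultimately show "(\<Union>x\<in>L \<inter> X\<^sub>1 - {i}. star x Y\<^sub>1) - A \<subseteq> R - (\<Union>x\<in>L \<inter> X\<^sub>2. B' x)"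
            by blast
        qed (use finA in auto)
        finally have bR: "b < card (R - (\<Union>x\<in>L \<inter> X\<^sub>2. B' x))" .
        have B'R: "B' j - A \<subseteq> R" if j: "j \<in> L \<inter> X\<^sub>2" for j
        proof -
          have "star j Y\<^sub>2 - A \<subseteq> R" using YR[of j] j X2[of j] by (simp add: Y_def)
          moreover have "{i, y j} \<in> A \<union> R"
            using YR[OF i(1)] y(1)[of j] True by (auto simp: Y_def star_def)
          moreover have "{j, y j} \<in> A \<union> R"
          proof (cases "nbrs A j \<inter> Y\<^sub>1 = {}")
            case True
            then have "star j Y\<^sub>1 \<subseteq> Bx A j" using j no_nbr by (simp add: Bx_def)
            moreover have "{j, y j} \<in> star j Y\<^sub>1" using y(1) by (auto simp: star_def)
            ultimately show ?thesis using BR[of j] j by blast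
          qed (use y in blast)
          ultimately show ?thesis unfolding B'_def by blast
        qed
        \<comment> \<open>Passing to the boxes \<open>B'\<close> loses no level: the extra level for
          a neighbour in \<open>Y\<^sub>1\<close> becomes the claimed edge
          \<open>{x, y x}\<close>.\<close>
        have lv_le: "lv A x \<le> card (A \<inter> B' x)" if x: "x \<in> L \<inter> X\<^sub>2" for x
        proof (cases "star x Y\<^sub>1 \<inter> A = {}")
          case True
          then show ?thesis using x X2[of x] finB'
            by (auto simp: lv_def Y_def B'_def intro!: card_mono)
        next
          case False
          then have xy: "{x, y x} \<in> A" using y(3) no_nbr by blast
          have "y x \<notin> Y\<^sub>2" using y(1)[of x] disj(6) by blast
          then have nin: "{x, y x} \<notin> star x Y\<^sub>2" by (auto simp: star_def doubleton_eq_iff)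
          have "lv A x = Suc (card (A \<inter> star x Y\<^sub>2))" using False x X2[of x] by (simp add: lv_def Y_def)
          also have "\<dots> = card (insert {x, y x} (A \<inter> star x Y\<^sub>2))" using nin fin by simp
          also have "\<dots> \<le> card (A \<inter> B' x)"
            using xy finB' by (intro card_mono) (auto simp: B'_def)
          finally show ?thesis .
        qed
        have "reserve m t (D + m) (L \<inter> X\<^sub>2) (lv A)" using res by simp
        then have "reserve m t (D + m) (L \<inter> X\<^sub>2) (\<lambda>x. card (A \<inter> B' x))"
          using lv_le by (rule reserve_mono)
        then have res': "reserve m t D (L \<inter> X\<^sub>2) (\<lambda>x. card (A \<inter> B' x))"
          by (rule reserve_weaken) simp
        show ?thesis
        proof (rule path_double_star_second_stage_left[OF mk, where L = "L \<inter> X\<^sub>2" and Y\<^sub>1 = Y\<^sub>1 and Y\<^sub>2 = Y\<^sub>2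
              and u = i and y = y])
          show "y x \<in> Y\<^sub>1 \<and> ({x, y x} \<in> A \<or> {i, y x} \<in> A)" for x using y by blast
          show "R \<noteq> {}" using bR by auto
          show "i < n" using True vert by auto
        qed (use True vert disj card U A cL' \<open>i \<notin> X\<^sub>2\<close>
              B'R[unfolded B'_def] res'[unfolded B'_def] bR[unfolded B'_def] in auto)
      next
        case False
        then have v: "i \<in> X\<^sub>2" using i L by auto
        \<comment> \<open>At most one of the \<open>k\<close> levels stems from a neighbour in
          \<open>Y\<^sub>1\<close>, so \<open>k - 1\<close> are leaves in
          \<open>Y\<^sub>2\<close>.\<close>
        have V: "k - 1 \<le> card (nbrs A i \<inter> Y\<^sub>2)"
          using i(2) False by (auto simp: lv_def Y_def card_Int_star mk split: if_splits)
        let ?B = "\<lambda>x. star x Y\<^sub>1 \<union> (if star i Y\<^sub>1 \<inter> A = {} then star i Y\<^sub>1 else {})"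
        have "b < card ((\<Union>x\<in>L \<inter> X\<^sub>2. star x Y\<^sub>2) - A)"
          using fin finA card disj cL' sparse by (intro many_free_edges) auto
        also have "\<dots> \<le> card (R - (\<Union>x\<in>L \<inter> X\<^sub>1. ?B x))"
        proof (rule card_mono)
          have "star j Y\<^sub>2 \<inter> star x Y\<^sub>1 = {}" if "j \<in> X\<^sub>2" "x \<in> X\<^sub>1 \<union> X\<^sub>2" for x j
            using that disj by (auto simp: star_def doubleton_eq_iff)
          then have "star j Y\<^sub>2 \<inter> ?B x = {}" if "j \<in> X\<^sub>2" "x \<in> X\<^sub>1" for x j
            using that v by auto
          moreover have "star j Y\<^sub>2 - A \<subseteq> R" if "j \<in> L \<inter> X\<^sub>2" for j
            using YR[of j] X2[of j] that by (simp add: Y_def)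
          ultimately show "(\<Union>x\<in>L \<inter> X\<^sub>2. star x Y\<^sub>2) - A \<subseteq> R - (\<Union>x\<in>L \<inter> X\<^sub>1. ?B x)"
            by blast
        qed (use finA in auto)
        finally have bR: "b < card (R - (\<Union>x\<in>L \<inter> X\<^sub>1. ?B x))" .
        have BR': "?B j - A \<subseteq> R" if "j \<in> L \<inter> X\<^sub>1" for j
        proof -
          have "star j Y\<^sub>1 - A \<subseteq> R" using YR[of j] that by (simp add: Y_def)
          moreover have "(if star i Y\<^sub>1 \<inter> A = {} then star i Y\<^sub>1 else {}) - A \<subseteq> R"
            using BR[OF i(1)] v by (auto simp: Bx_def)
          ultimately show ?thesis by blast
        qed
        have "reserve m t (D + m) (L \<inter> X\<^sub>1) (lv A)" using res by simp
        then have "reserve m t (D + m) (L \<inter> X\<^sub>1)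
            (\<lambda>x. card (A \<inter> star x Y\<^sub>1) + (if star i Y\<^sub>1 \<inter> A = {} then 0 else 1))"
          by (rule reserve_mono) (auto simp: lv_def Y_def dest: X2)
        then have res': "reserve m t D (L \<inter> X\<^sub>1)
            (\<lambda>x. card (A \<inter> star x Y\<^sub>1) + (if star i Y\<^sub>1 \<inter> A = {} then 0 else 1))"
          by (rule reserve_weaken) simp
        show ?thesis
        proof (rule path_double_star_second_stage_right[OF mk, where L = "L \<inter> X\<^sub>1" and Y = Y\<^sub>1
              and v = i and V = "nbrs A i \<inter> Y\<^sub>2"])
          show "R \<noteq> {}" using bR by auto
          show "i < n" using v vert by auto
          show "b \<le> card (R - (\<Union>x\<in>L \<inter> X\<^sub>1. ?B x))" using bR by simp
          show "star j Y\<^sub>1 \<union> (if star i Y\<^sub>1 \<inter> A = {} then star i Y\<^sub>1 else {}) - A \<subseteq> R"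
            if "j \<in> L \<inter> X\<^sub>1" for j using BR'[OF that] .
          show "L \<inter> X\<^sub>1 \<subseteq> {..<n}" "L \<inter> X\<^sub>1 \<inter> Y\<^sub>1 = {}" "L \<inter> X\<^sub>1 \<inter> (nbrs A i \<inter> Y\<^sub>2) = {}"
            "Y\<^sub>1 \<inter> (nbrs A i \<inter> Y\<^sub>2) = {}" "i \<notin> L \<inter> X\<^sub>1" "i \<notin> Y\<^sub>1"
            using vert(1) disj False v by blast+
        qed (use vert(3) card(3) V A cL' res' in simp_all)
      qed
    qed simp
  qed (use fin mq m1 b YB B_K in auto)
  have D1: "(D + m) * (t + 1) \<le> q" "D * (t + 1) \<le> q"
  proof -
    have "reserve m t (D + m) X\<^sub>1 (\<lambda>_. 0)" using q card by (intro reserve_initial) simp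
    then show "(D + m) * (t + 1) \<le> q" using m1 card by (auto dest!: reserve_card)
    then show "D * (t + 1) \<le> q" by (simp add: add_mult_distrib)
  qed
  show ?thesis unfolding enforcer_wins_def
  proof (rule avoider_step)
    have "0 < card X\<^sub>1" "0 < card X\<^sub>2" using card mq m1 by auto
    then obtain x y where xy: "x \<in> X\<^sub>1" "y \<in> X\<^sub>2" by (metis card_gt_0_iff ex_in_conv)
    then have "{x, y} \<in> K\<^sub>E n" using K\<^sub>E_iff[of x y n] vert disj by auto
    then show "K\<^sub>E n \<noteq> {}" by blast
    fix S assume "legal_move 1 (K\<^sub>E n) S"
    then have S: "S \<subseteq> K\<^sub>E n" by (simp add: legal_move_def)
    have finS: "finite S" using S finite_edges_complete_graph finite_subset by blast
    show "enforcer_wins_enforcer_moves ?\<F> b ({} \<union> S) (K\<^sub>E n - S)"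
    proof (rule enforcer_wins_or_sparse)
      assume "card ({} \<union> S) \<le> (2 * k + 2) * n"
      then have "b < card ((\<Union>i\<in>X\<^sub>1. star i Y\<^sub>2) - S)"
        using fin finS card disj D1 by (intro many_free_edges) auto
      also have "\<dots> \<le> card (K\<^sub>E n - S - (\<Union>i\<in>X\<^sub>1 \<union> X\<^sub>2. Bx S i))"
      proof (rule card_mono)
        have "star i Y\<^sub>2 \<subseteq> K\<^sub>E n" if "i \<in> X\<^sub>1" for i
          using that vert disj by (intro star_subset_K\<^sub>E) auto
        moreover have "star i Y\<^sub>2 \<inter> Bx S j = {}" if "i \<in> X\<^sub>1" "j \<in> X\<^sub>1 \<union> X\<^sub>2" for i j
        proof -
          have "star i Y\<^sub>2 \<inter> star j (Y j) = {}" "star i Y\<^sub>2 \<inter> star j Y\<^sub>1 = {}"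
            using that disj by (auto simp: star_def doubleton_eq_iff Y_def)
          then show ?thesis by (auto simp: Bx_def)
        qed
        ultimately show "(\<Union>i\<in>X\<^sub>1. star i Y\<^sub>2) - S \<subseteq> K\<^sub>E n - S - (\<Union>i\<in>X\<^sub>1 \<union> X\<^sub>2. Bx S i)"
          by blast
      qed (simp add: finite_edges_complete_graph)
      finally have bR: "b < card (K\<^sub>E n - S - (\<Union>i\<in>X\<^sub>1 \<union> X\<^sub>2. Bx S i))" .
      have Int: "(X\<^sub>1 \<union> X\<^sub>2) \<inter> c = c" if "c \<in> {X\<^sub>1, X\<^sub>2}" for c using that by auto
      show "enforcer_wins_enforcer_moves ?\<F> b ({} \<union> S) (K\<^sub>E n - S)"
      proof (rule enforcer_to_move[where L = "X\<^sub>1 \<union> X\<^sub>2"])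
        show "reserve m t (D + m) ((X\<^sub>1 \<union> X\<^sub>2) \<inter> c) (lv ({} \<union> S))"
          if "c \<in> {X\<^sub>1, X\<^sub>2}" for c
          using q card that by (intro reserve_initial) (auto simp: Int)
        show "(D + m) * (t + 1) \<le> card ((X\<^sub>1 \<union> X\<^sub>2) \<inter> c)" if "c \<in> {X\<^sub>1, X\<^sub>2}" for c
          unfolding Int[OF that] using that D1 card by auto
        show "Bx ({} \<union> S) j - ({} \<union> S) \<subseteq> K\<^sub>E n - S" if "j \<in> X\<^sub>1 \<union> X\<^sub>2" for j
          using B_K[OF that, of S] by auto
        show "K\<^sub>E n - S \<noteq> {}" using bR by (metis card.empty empty_Diff not_less_zero)
      qed (use S bR in auto)
    qed (use S in \<open>auto simp: finite_edges_complete_graph\<close>)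
  qed
qed

section \<open>Four blocks of consecutive vertices\<close>

lemma double_star_enforcer_wins:
  assumes k: "3 \<le> k" and q: "(16 * k + 17 + 2 * (k - 1)) * (t + 1) ^ (k - 1) \<le> n div 4"
  shows "enforcer_wins (double_star k) n (t * (n div 4 - (k - 1)))"
proof -
  define q' where "q' = n div 4"
  have "16 * k + 17 + 2 * (k - 1) \<le> (16 * k + 17 + 2 * (k - 1)) * (t + 1) ^ (k - 1)"
    by simp
  then have le: "16 * k + 17 + 2 * (k - 1) \<le> q'" using q unfolding q'_def by (rule le_trans)
  have n: "4 * q' \<le> n" "n \<le> 4 * q' + 3" unfolding q'_def by linarith+
  interpret enforcer_setting n q' "k - 1" k t "t * (q' - (k - 1))" "16 * k + 17"
    using k le n by unfold_locales auto
  have "enforcer_wins (double_star k) n (t * (q' - (k - 1)))"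
    by (rule double_star_first_stage[of "{..<q'}" "{q'..<2*q'}" "{2*q'..<3*q'}" "{3*q'..<4*q'}"])
      (use n q in \<open>auto simp: q'_def[symmetric] algebra_simps\<close>)
  then show "enforcer_wins (double_star k) n (t * (n div 4 - (k - 1)))" by (simp add: q'_def)
qed

lemma path_double_star_enforcer_wins:
  assumes k: "3 \<le> k" and q: "(16 * k + 17 + 2 * k) * (t + 1) ^ k \<le> n div 4"
  shows "enforcer_wins (path_double_star k) n (t * (n div 4 - k))"
proof -
  define q' where "q' = n div 4"
  have "16 * k + 17 + 2 * k \<le> (16 * k + 17 + 2 * k) * (t + 1) ^ k" by simp
  then have le: "16 * k + 17 + 2 * k \<le> q'" using q unfolding q'_def by (rule le_trans)
  have n: "4 * q' \<le> n" "n \<le> 4 * q' + 3" unfolding q'_def by linarith+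
  interpret enforcer_setting n q' k k t "t * (q' - k)" "16 * k + 17"
    using k le n by unfold_locales auto
  have "enforcer_wins (path_double_star k) n (t * (q' - k))"
    by (rule path_double_star_first_stage[of "{..<q'}" "{q'..<2*q'}" "{2*q'..<3*q'}" "{3*q'..<4*q'}"])
      (use n q in \<open>auto simp: q'_def[symmetric] algebra_simps\<close>)
  then show ?thesis by (simp add: q'_def)
qed

section \<open>Asymptotics\<close>

text \<open>The largest admissible \<open>t\<close> is about \<open>(q / M) powr (1/m)\<close> with
  \<open>q = n div 4\<close>, which makes \<open>t * (q - m)\<close> of order
  \<open>n powr (1 + 1/m)\<close>.\<close>

lemma bigtheta_from_bounds:
  fixes f :: "nat \<Rightarrow> nat" and m M :: nat
  assumes m: "1 \<le> m" and M: "1 \<le> M"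
    and up: "\<And>n. real (f n) \<le> real m * real n powr ((real m + 1) / real m)"
    and low: "\<And>n t. M * (t + 1) ^ m \<le> n div 4 \<Longrightarrow> 1 \<le> t * (n div 4 - m) \<Longrightarrow>
      t * (n div 4 - m) \<le> f n"
  shows "(\<lambda>n. real (f n)) \<in> \<Theta>(\<lambda>n. real n powr ((real m + 1) / real m))"
proof (rule bigthetaI)
  show "(\<lambda>n. real (f n)) \<in> O(\<lambda>n. real n powr ((real m + 1) / real m))"
    using up by (intro bigoI[where c = "real m"]) auto
  define c where "c = (1 / 32) * (1 / (8 * real M)) powr (1 / real m)"
  have c0: "c > 0" using M by (simp add: c_def)
  have "c * real n powr ((real m + 1) / real m) \<le> real (f n)"
    if n: "n \<ge> 8 * (M * 4 ^ m + 2 * m + 1)" for n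
  proof -
    define q where "q = n div 4"
    define Q where "Q = M * 4 ^ m"
    have n: "8 * (Q + 2 * m + 1) \<le> n" using n by (simp add: Q_def)
    have "8 \<le> n" using n by presburger
    then have nq: "n \<le> 8 * q" unfolding q_def by presburger
    then have q: "Q + 2 * m + 1 \<le> q" using n by presburger
    define r where "r = (real q / real M) powr (1 / real m)"
    have rm: "r ^ m = real q / real M"
      using m M q by (simp add: r_def powr_realpow[symmetric] powr_powr)
    have "real (4 ^ m) \<le> real q / real M"
    proof -
      have "real Q \<le> real q" using q by linarith
      then show ?thesis using M by (simp add: Q_def field_simps)
    qed
    then have "4 ^ m \<le> r ^ m" by (simp add: rm)
    moreover have r0: "r \<ge> 0" by (simp add: r_def)
    ultimately have r4: "4 \<le> r" using m power_mono_iff[of 4 r m] by simp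
    define T where "T = nat \<lfloor>r\<rfloor>"
    have T: "real T \<le> r" "r < real T + 1" using r0 by (auto simp: T_def)
    then have T4: "T \<ge> 4" using r4 by linarith
    define t where "t = T - 1"
    have tT: "t + 1 = T" using T4 by (simp add: t_def)
    have "real T ^ m \<le> real q / real M" using T rm power_mono[of "real T" r m] by simp
    then have "real (M * T ^ m) \<le> real q" using M by (simp add: field_simps)
    then have 1: "M * (t + 1) ^ m \<le> n div 4" unfolding tT q_def[symmetric] by linarith
    have t: "real t \<ge> r / 2" using T r4 tT by linarith
    have qm: "real (q - m) \<ge> real q / 2" "q - m \<ge> 1" using q by linarith+
    have "1 * 1 \<le> t * (q - m)" using T4 qm(2) by (intro mult_mono) (auto simp: t_def)
    then have "t * (q - m) \<le> f n" using low[OF 1] by (simp add: q_def)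
    then have "real t * real (q - m) \<le> real (f n)" by (metis of_nat_le_iff of_nat_mult)
    moreover have "(r / 2) * (real q / 2) \<le> real t * real (q - m)"
      using t qm r0 by (intro mult_mono) auto
    moreover have "c * real n powr ((real m + 1) / real m) \<le> (r / 2) * (real q / 2)"
    proof -
      have n8: "real n / 8 \<le> real q" using nq by linarith
      have "(1 / (8 * real M)) powr (1 / real m) * real n powr (1 / real m)
          = (real n / (8 * real M)) powr (1 / real m)"
        by (simp add: powr_mult[symmetric])
      also have "\<dots> \<le> r"
        unfolding r_def using n8 M by (intro powr_mono2) (auto simp: field_simps)
      finally have r': "(1 / (8 * real M)) powr (1 / real m) * real n powr (1 / real m) \<le> r" .
      have "(real m + 1) / real m = 1 / real m + 1" using m by (simp add: field_simps)
      then have "real n powr ((real m + 1) / real m) = real n powr (1 / real m) * real n"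
        by (simp add: powr_add)
      then have "c * real n powr ((real m + 1) / real m)
          = ((1 / (8 * real M)) powr (1 / real m) * real n powr (1 / real m)) / 2 * ((real n / 8) / 2)"
        by (simp add: c_def)
      also have "\<dots> \<le> (r / 2) * (real q / 2)"
        using r' n8 r0 by (intro mult_mono) auto
      finally show ?thesis .
    qed
    ultimately show ?thesis by linarith
  qed
  then have "\<forall>\<^sub>F n in at_top. c * norm (real n powr ((real m + 1) / real m)) \<le> norm (real (f n))"
    unfolding eventually_at_top_linorder by (intro exI[of _ "8 * (M * 4 ^ m + 2 * m + 1)"]) auto
  then show "(\<lambda>n. real (f n)) \<in> \<Omega>(\<lambda>n. real n powr ((real m + 1) / real m))"
    using c0 by (intro landau_omega.bigI) auto
qed

theorem theorem2:
  fixes k :: nat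
  assumes "k \<ge> 3"
  shows "(\<lambda>n. real (mon_threshold_bias (double_star k) n))
           \<in> \<Theta>(\<lambda>n. real n powr (real k / (real k - 1)))
       \<and> (\<lambda>n. real (mon_threshold_bias (path_double_star k) n))
           \<in> \<Theta>(\<lambda>n. real n powr ((real k + 1) / real k))"
proof
  have "(\<lambda>n. real (mon_threshold_bias (double_star k) n))
      \<in> \<Theta>(\<lambda>n. real n powr ((real (k - 1) + 1) / real (k - 1)))"
  proof (rule bigtheta_from_bounds[where M = "16 * k + 17 + 2 * (k - 1)"])
    show "real (mon_threshold_bias (double_star k) n)
        \<le> real (k - 1) * real n powr ((real (k - 1) + 1) / real (k - 1))" for n
      using mon_threshold_bias_le[OF double_star_wf[OF assms], of "k - 1" n]
        double_star_copy_minus_edge[OF assms] assms by simp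
    show "t * (n div 4 - (k - 1)) \<le> mon_threshold_bias (double_star k) n"
      if "(16 * k + 17 + 2 * (k - 1)) * (t + 1) ^ (k - 1) \<le> n div 4"
        "1 \<le> t * (n div 4 - (k - 1))" for n t
      using double_star_enforcer_wins[OF assms that(1)]
        mon_threshold_bias_iff[OF double_star_wf[OF assms] that(2), of n] by simp
  qed (use assms in auto)
  then show "(\<lambda>n. real (mon_threshold_bias (double_star k) n))
           \<in> \<Theta>(\<lambda>n. real n powr (real k / (real k - 1)))"
    using assms by (simp add: of_nat_diff)
  show "(\<lambda>n. real (mon_threshold_bias (path_double_star k) n))
           \<in> \<Theta>(\<lambda>n. real n powr ((real k + 1) / real k))"
  proof (rule bigtheta_from_bounds[where M = "16 * k + 17 + 2 * k"])
    show "real (mon_threshold_bias (path_double_star k) n)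
        \<le> real k * real n powr ((real k + 1) / real k)" for n
      using mon_threshold_bias_le[OF path_double_star_wf[OF assms], of k n]
        path_double_star_copy_minus_edge[OF assms] assms by simp
    show "t * (n div 4 - k) \<le> mon_threshold_bias (path_double_star k) n"
      if "(16 * k + 17 + 2 * k) * (t + 1) ^ k \<le> n div 4" "1 \<le> t * (n div 4 - k)" for n t
      using path_double_star_enforcer_wins[OF assms that(1)]
        mon_threshold_bias_iff[OF path_double_star_wf[OF assms] that(2), of n] by simp
  qed (use assms in auto)
qed

end
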